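(* Let $\{Y_i\}_{i\ge1}$ be i.i.d. random variables which are right tail equivalent to a generalized Weibull-like distribution with parameters $C,\tau>0$ and function $\rho$. Suppose that $$\limsup_{x\to\infty}\mathbb{P}\{Y_1<-x\}\,x^\eta<\infty$$ holds for some $\eta>0$. Let $k\ge1$ be a fixed integer and let $Y_n^{(k)}$ be the $k$th largest of $Y_1,\dots,Y_n$. Then, for any $\lambda>0$, $$\lim_{n\to\infty}\mathbb{E}\left\{\left|\nu_n^{-1}\left(Y_n^{(k)}-\mu_n\right)\right|^\lambda\right\}=\mathbb{E}\left\{\left|\Lambda^{(k)}\right|^\lambda\right\}.$$
   Context: A distribution function $F$ is a generalized Weibull-like distribution if $F(x)=1-\rho(x)\exp(-Cx^\tau)$ for $x\ge x_0$, for some $x_0>0$, where $C,\tau$ are positive constants and $\rho(x)>0$ is a regularly varying function at infinity with index $\gamma\in\mathbb{R}$. The $Y_i$ being right tail equivalent to $F$ means $\mathbb{P}\{Y_1>x\}=(1-F(x))(1+o(1))$ as $x\to\infty$. The normalising sequences are $$\mu_n=(C^{-1}\log n)^{1/\tau}+\frac1\tau(C^{-1}\log n)^{1/\tau-1}\left(C^{-1}\log\left(\rho((C^{-1}\log n)^{1/\tau})\right)\right),\qquad \nu_n=(C\tau)^{-1}(C^{-1}\log n)^{1/\tau-1}.$$ $\Lambda^{(k)}=-\ln E_k$, with $E_k$ an Erlang distributed random variable with shape parameter $k$ and rate parameter $1$. *)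

theory Defs
  imports "HOL-Probability.Probability" "HOL-Library.Landau_Symbols"
begin

text \<open>Positivity and measurability are only required on a neighbourhood of infinity.\<close>

definition regularly_varying :: "(real \<Rightarrow> real) \<Rightarrow> real \<Rightarrow> bool" where
  "regularly_varying f \<gamma> \<longleftrightarrow>
     (\<exists>a. (\<forall>x\<ge>a. f x > 0) \<and> f \<in> borel_measurable (restrict_space borel {a..})) \<and>
     (\<forall>t>0. ((\<lambda>x. f (t * x) / f x) \<longlongrightarrow> t powr \<gamma>) at_top)"

definition generalized_Weibull_like ::
    "(real \<Rightarrow> real) \<Rightarrow> real \<Rightarrow> real \<Rightarrow> (real \<Rightarrow> real) \<Rightarrow> bool" where
  "generalized_Weibull_like F C \<tau> \<rho> \<longleftrightarrow>
     (\<exists>D. real_distribution D \<and> F = cdf D) \<and>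
     C > 0 \<and> \<tau> > 0 \<and>
     (\<exists>\<gamma>. regularly_varying \<rho> \<gamma>) \<and>
     (\<exists>x\<^sub>0>0. \<forall>x\<ge>x\<^sub>0. \<rho> x > 0 \<and> F x = 1 - \<rho> x * exp (- C * x powr \<tau>))"

text \<open>Since \<open>1 - F\<close> is eventually positive in the case of interest, this is
  \<open>P(X > x) = (1 - F x) (1 + o(1))\<close> as \<open>x\<close> tends to infinity.\<close>

definition right_tail_equivalent :: "'a measure \<Rightarrow> ('a \<Rightarrow> real) \<Rightarrow> (real \<Rightarrow> real) \<Rightarrow> bool" where
  "right_tail_equivalent M X F \<longleftrightarrow>
     (\<lambda>x. \<P>(\<omega> in M. X \<omega> > x)) \<sim>[at_top] (\<lambda>x. 1 - F x)"

definition weibull_mu :: "real \<Rightarrow> real \<Rightarrow> (real \<Rightarrow> real) \<Rightarrow> nat \<Rightarrow> real" where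
  "weibull_mu C \<tau> \<rho> n =
     (inverse C * ln (real n)) powr (1 / \<tau>) +
     1 / \<tau> * (inverse C * ln (real n)) powr (1 / \<tau> - 1) *
       (inverse C * ln (\<rho> ((inverse C * ln (real n)) powr (1 / \<tau>))))"

definition weibull_nu :: "real \<Rightarrow> real \<Rightarrow> nat \<Rightarrow> real" where
  "weibull_nu C \<tau> n = inverse (C * \<tau>) * (inverse C * ln (real n)) powr (1 / \<tau> - 1)"

text \<open>The \<open>k\<close>th largest entry, counted with multiplicity and from \<open>k = 1\<close>;
  meaningful only for \<open>1 \<le> k \<le> length xs\<close>.\<close>

definition kth_largest :: "nat \<Rightarrow> real list \<Rightarrow> real" where
  "kth_largest k xs = rev (sort xs) ! (k - 1)"

definition order_stat :: "(nat \<Rightarrow> 'a \<Rightarrow> real) \<Rightarrow> nat \<Rightarrow> nat \<Rightarrow> 'a \<Rightarrow> real" where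
  "order_stat Y k n \<omega> = kth_largest k (map (\<lambda>i. Y i \<omega>) [1..<Suc n])"

text \<open>The library's \<open>erlang_density m l\<close> has shape \<open>m + 1\<close> and rate \<open>l\<close>.\<close>

definition erlang_distributed :: "'b measure \<Rightarrow> ('b \<Rightarrow> real) \<Rightarrow> nat \<Rightarrow> bool" where
  "erlang_distributed N E k \<longleftrightarrow> distributed N lborel E (\<lambda>x. ennreal (erlang_density (k - 1) 1 x))"

end

theory Submission
  imports Defs "HOL-Real_Asymp.Real_Asymp"
begin

text \<open>Write \<open>G\<close> for the common tail \<open>P(Y > x)\<close>. The \<open>k\<close>th largest of \<open>n\<close> variables is at most \<open>y\<close> exactly if fewer than
  \<open>k\<close> of them exceed \<open>y\<close>, and the number of exceedances is binomial with parameters \<open>n\<close> and \<open>G y\<close>. So all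
  questions about the order statistic are questions about the size of \<open>n * G y\<close>.

  If \<open>y = \<mu>\<^sub>n + \<nu>\<^sub>n x\<close> with \<open>x\<close> fixed, then \<open>n * G y\<close> tends to \<open>exp (- x)\<close> (\<open>tail_at_normalised_point\<close>): the
  sequences are chosen so that a first order expansion of \<open>C * y powr \<tau>\<close> yields \<open>ln n + ln \<rho> + x\<close>, and
  regular variation, made locally uniform by the theorem of Karamata
  (\<open>uniform_convergence_slowly_varying\<close>), allows replacing \<open>\<rho> y\<close> by \<open>\<rho>\<close> at the leading term of \<open>\<mu>\<^sub>n\<close>.
  The Poisson limit of the binomial distribution then gives convergence in distribution to
  \<open>\<Lambda>\<^sup>(\<^sup>k\<^sup>) = - ln E\<^sub>k\<close>, because the Erlang distribution function is a sum of Poisson probabilities.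

  For the moments it remains to bound \<open>P(\<bar>Z\<^sub>n\<bar> > s)\<close> for the normalised order statistic \<open>Z\<^sub>n\<close> by a multiple of
  \<open>s powr - m\<close> for some \<open>m\<close> above the order of the moment, uniformly in large \<open>n\<close>
  (\<open>uniform_polynomial_tail\<close>); dominated convergence does the rest (\<open>absolute_moments_converge\<close>).
  On the right, \<open>P(Z\<^sub>n > s) \<le> n * G (\<mu>\<^sub>n + \<nu>\<^sub>n s)\<close>, and a Potter bound shows that this is at most a
  multiple of any prescribed negative power of \<open>s\<close>, uniformly in large \<open>n\<close> (\<open>right_tail_bound\<close>). On the left there are two regimes. As long as
  \<open>\<nu>\<^sub>n s \<le> 3 \<mu>\<^sub>n\<close>, the mean number of exceedances of \<open>\<mu>\<^sub>n - \<nu>\<^sub>n s\<close> grows exponentially in \<open>s\<close>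
  (\<open>left_tail_growth\<close>), and the probability of fewer than \<open>k\<close> exceedances is at most a constant
  multiple of the reciprocal of that mean (\<open>binomial_lt_bound\<close>). Beyond, the level lies below \<open>- 2 \<mu>\<^sub>n\<close>, almost all variables
  must lie far to the left, and the assumed polynomial left tail raised to a power of order \<open>n\<close> is
  more than enough (\<open>far_left_bound\<close>).\<close>

section \<open>Uniform convergence for slowly varying functions\<close>

text \<open>For uniform convergence, two sets are needed that must overlap inside an interval of length 3;
  each gets measure above 3/2 by continuity of measure from below on \<open>[0, 2]\<close>.\<close>

lemma increasing_sets_measure_exceeds:
  fixes A :: "nat \<Rightarrow> real set"
  assumes A: "\<And>n. A n \<in> sets lborel" "incseq A" and cover: "{0..2} \<subseteq> (\<Union>n. A n)"
  shows "\<forall>\<^sub>F n in sequentially. measure lborel (A n \<inter> {0..2}) > 3/2"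
proof -
  have fm: "A n \<inter> {0..2} \<in> fmeasurable lborel" for n
    by (rule fmeasurableI2[of "{0..2}"]) (use A in \<open>auto simp: fmeasurable_def\<close>)
  have "(\<lambda>n. emeasure lborel (A n \<inter> {0..2})) \<longlonglongrightarrow> emeasure lborel (\<Union>n. A n \<inter> {0..2})"
    using A by (intro Lim_emeasure_incseq) (auto simp: incseq_def)
  also have "(\<Union>n. A n \<inter> {0..2}) = {0..2}" using cover by auto
  also have "emeasure lborel {0..2::real} = ennreal 2" by simp
  finally have "(\<lambda>n. ennreal (measure lborel (A n \<inter> {0..2}))) \<longlonglongrightarrow> ennreal 2"
    using fm by (simp add: emeasure_eq_measure2)
  hence "(\<lambda>n. measure lborel (A n \<inter> {0..2})) \<longlonglongrightarrow> 2"
    by (subst (asm) tendsto_ennreal_iff) auto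
  thus ?thesis by (rule order_tendstoD) simp
qed

text \<open>The uniform convergence theorem of Karamata, in additive form. If uniformity fails along
  \<open>x\<^sub>n\<close> and \<open>u\<^sub>n\<close>, pointwise convergence along the two sequences \<open>x\<^sub>n\<close> and \<open>x\<^sub>n + u\<^sub>n\<close> produces, for
  large \<open>n\<close>, two sets of good shifts of measure above 3/2. After translating the second one by
  \<open>u\<^sub>n\<close> both lie in \<open>[0, 3]\<close>, so they share a point, which links \<open>h (x\<^sub>n)\<close> to \<open>h (x\<^sub>n + u\<^sub>n)\<close> through a
  common third value.\<close>

lemma uniform_convergence_slowly_varying:
  fixes h :: "real \<Rightarrow> real"
  assumes [measurable]: "h \<in> borel_measurable borel"
    and lim: "\<And>u. ((\<lambda>x. h (x + u) - h x) \<longlongrightarrow> 0) at_top"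
    and "\<epsilon> > 0"
  shows "\<exists>X. \<forall>x\<ge>X. \<forall>u\<in>{0..1}. \<bar>h (x + u) - h x\<bar> \<le> \<epsilon>"
proof (rule ccontr)
  assume "\<not> ?thesis"
  hence "\<forall>n::nat. \<exists>x u. x \<ge> real n \<and> u \<in> {0..1} \<and> \<bar>h (x + u) - h x\<bar> > \<epsilon>"
    by (meson not_le)
  then obtain x u where x: "\<And>n. x n \<ge> real n" and u: "\<And>n. u n \<in> {0..1}"
    and big: "\<And>n. \<bar>h (x n + u n) - h (x n)\<bar> > \<epsilon>"
    by metis
  \<comment> \<open>Each shift is eventually good, along any sequence tending to infinity.\<close>
  have cover: "{0..2} \<subseteq> (\<Union>n. {y. \<forall>m\<ge>n. \<bar>h (z m + y) - h (z m)\<bar> < \<epsilon>/2})"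
    if z: "\<And>n. z n \<ge> real n" for z :: "nat \<Rightarrow> real"
  proof
    fix y
    have "filterlim z at_top sequentially"
      by (rule filterlim_at_top_mono[OF filterlim_real_sequentially]) (use z in auto)
    hence "(\<lambda>m. h (z m + y) - h (z m)) \<longlonglongrightarrow> 0"
      using lim[of y] by (rule filterlim_compose[rotated])
    hence "\<forall>\<^sub>F m in sequentially. \<bar>h (z m + y) - h (z m)\<bar> < \<epsilon>/2"
      using \<open>\<epsilon> > 0\<close> unfolding tendsto_iff dist_real_def
      by (elim allE[of _ "\<epsilon>/2"]) simp
    thus "y \<in> (\<Union>n. {y. \<forall>m\<ge>n. \<bar>h (z m + y) - h (z m)\<bar> < \<epsilon>/2})"
      by (auto simp: eventually_sequentially)
  qed
  define U where "U z n = {y. \<forall>m\<ge>n. \<bar>h (z m + y) - h (z m)\<bar> < \<epsilon>/2}" for z :: "nat \<Rightarrow> real" and n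
  have U_sets [measurable]: "U z n \<in> sets borel" for z n unfolding U_def by measurable
  have U_mono: "incseq (U z)" for z unfolding U_def incseq_def by fastforce
  have ev: "\<forall>\<^sub>F n in sequentially. measure lborel (U z n \<inter> {0..2}) > 3/2"
    if "\<And>n. z n \<ge> real n" for z
  proof (rule increasing_sets_measure_exceeds)
    show "{0..2} \<subseteq> (\<Union>n. U z n)" unfolding U_def by (rule cover[OF that])
  qed (use U_mono U_sets in auto)
  define z where "z n = x n + u n" for n
  have z: "z n \<ge> real n" for n using x[of n] u[of n] by (auto simp: z_def)
  obtain n where n: "measure lborel (U x n \<inter> {0..2}) > 3/2" "measure lborel (U z n \<inter> {0..2}) > 3/2"
    using eventually_happens[OF eventually_conj[OF ev[OF x] ev[OF z]]] by auto
  \<comment> \<open>Translating by \<open>u n\<close> expresses the good shifts of \<open>z n\<close> relative to \<open>x n\<close>.\<close>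
  define V where "V = (\<lambda>y. u n + y) ` (U z n \<inter> {0..2})"
  have V_eq: "V = (+) (- u n) -` (U z n \<inter> {0..2})"
  proof (intro set_eqI iffI)
    fix w assume w: "w \<in> (+) (- u n) -` (U z n \<inter> {0..2})"
    have "w = u n + (- u n + w)" by simp
    thus "w \<in> V" using w unfolding V_def by blast
  qed (auto simp: V_def)
  have [measurable]: "V \<in> sets borel"
    unfolding V_eq by (rule measurable_sets_borel[where M=borel]) auto
  have "emeasure lborel (U z n \<inter> {0..2}) = emeasure (distr lborel borel ((+) (- u n))) (U z n \<inter> {0..2})"
    by (simp add: lborel_distr_plus)
  also have "\<dots> = emeasure lborel V"
    by (subst emeasure_distr) (simp_all only: V_eq space_borel space_lborel Int_UNIV_right, auto)
  finally have mV: "measure lborel V > 3/2" using n(2) by (simp add: measure_def)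
  have sub: "V \<subseteq> {0..3}" "U x n \<inter> {0..2} \<subseteq> {0..3}" unfolding V_def using u[of n] by auto
  have "V \<inter> (U x n \<inter> {0..2}) \<noteq> {}"
  proof
    assume disj: "V \<inter> (U x n \<inter> {0..2}) = {}"
    have fm: "V \<in> fmeasurable lborel" "U x n \<inter> {0..2} \<in> fmeasurable lborel"
      by (rule fmeasurableI2[of "{0..3}"]; use sub in \<open>auto simp: fmeasurable_def\<close>)+
    have "measure lborel V + measure lborel (U x n \<inter> {0..2}) = measure lborel (V \<union> (U x n \<inter> {0..2}))"
      using fm disj by (subst measure_Un2) (auto simp: Diff_triv Int_commute)
    also have "\<dots> \<le> measure lborel {0..3::real}"
      using sub fm by (intro measure_mono_fmeasurable) (auto simp: fmeasurable_def)
    finally show False using mV n(1) by simp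
  qed
  then obtain y where y: "y \<in> U z n" "u n + y \<in> U x n" by (auto simp: V_def)
  hence "\<bar>h (x n + (u n + y)) - h (z n)\<bar> < \<epsilon>/2" "\<bar>h (x n + (u n + y)) - h (x n)\<bar> < \<epsilon>/2"
    by (auto simp: U_def z_def add.assoc)
  with big[of n] show False unfolding z_def by argo
qed

section \<open>Tails of Weibull type\<close>

lemma ln_ratio_in_unit:
  fixes x y :: real
  assumes "x > 0" "y \<in> {x..exp 1 * x}"
  shows "ln (y / x) \<in> {0..1}"
proof -
  have "1 \<le> y / x" "y / x \<le> exp 1" using assms by (simp_all add: divide_le_eq)
  hence "ln (y / x) \<le> ln (exp 1)" by (subst ln_le_cancel_iff) auto
  thus ?thesis using \<open>1 \<le> y / x\<close> by simp
qed

text \<open>The function \<open>G\<close> stands for a tail \<open>P(X > x)\<close> that is asymptotically equivalent to a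
  generalized Weibull-like one.\<close>

locale weibull_type_tail =
  fixes G \<rho> :: "real \<Rightarrow> real" and C \<tau> \<gamma> :: real
  assumes antimono_G: "antimono G"
    and C_pos: "C > 0" and \<tau>_pos: "\<tau> > 0"
    and rho_pos: "\<forall>\<^sub>F x in at_top. \<rho> x > 0"
    and rho_rv: "\<And>t. t > 0 \<Longrightarrow> ((\<lambda>x. \<rho> (t * x) / \<rho> x) \<longlongrightarrow> t powr \<gamma>) at_top"
    and G_equiv: "((\<lambda>x. G x / (\<rho> x * exp (- C * x powr \<tau>))) \<longlongrightarrow> 1) at_top"
begin

text \<open>The logarithm of \<open>G x * exp (C * x powr \<tau>)\<close>, which is \<open>ln (\<rho> x) + o(1)\<close>. Building it from the
  monotone \<open>G\<close> gives a Borel function on the whole line, and a bound on \<open>L\<close> is an exact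
  bound on \<open>G\<close> with no error factor to carry along.\<close>

definition L :: "real \<Rightarrow> real" where "L x = ln (G x) + C * x powr \<tau>"

lemma G_pos: "\<forall>\<^sub>F x in at_top. G x > 0"
proof -
  have "\<forall>\<^sub>F x in at_top. G x / (\<rho> x * exp (- C * x powr \<tau>)) > 0"
    using G_equiv by (rule order_tendstoD) simp
  with rho_pos show ?thesis
    by eventually_elim (auto simp: zero_less_divide_iff mult_less_0_iff)
qed

lemma G_eq: "G x > 0 \<Longrightarrow> G x = exp (L x - C * x powr \<tau>)"
  by (simp add: L_def)

lemma L_minus_ln_rho: "((\<lambda>x. L x - ln (\<rho> x)) \<longlongrightarrow> 0) at_top"
proof -
  have "((\<lambda>x. ln (G x / (\<rho> x * exp (- C * x powr \<tau>)))) \<longlongrightarrow> ln 1) at_top"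
    by (intro tendsto_ln G_equiv) simp
  moreover have "\<forall>\<^sub>F x in at_top. ln (G x / (\<rho> x * exp (- C * x powr \<tau>))) = L x - ln (\<rho> x)"
    using G_pos rho_pos by eventually_elim (simp add: L_def ln_div ln_mult)
  ultimately show ?thesis by (simp cong: filterlim_cong)
qed

lemma L_regular_variation:
  assumes "t > 0"
  shows "((\<lambda>x. L (t * x) - L x) \<longlongrightarrow> \<gamma> * ln t) at_top"
proof -
  have tt: "filterlim (\<lambda>x. t * x) at_top at_top"
    using assms by (simp add: filterlim_tendsto_pos_mult_at_top[OF tendsto_const _ filterlim_ident])
  have "((\<lambda>x. ln (\<rho> (t * x) / \<rho> x)) \<longlongrightarrow> ln (t powr \<gamma>)) at_top"
    by (intro tendsto_ln rho_rv assms) (use assms in auto)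
  moreover have "\<forall>\<^sub>F x in at_top. ln (\<rho> (t * x) / \<rho> x) = ln (\<rho> (t * x)) - ln (\<rho> x)"
    using rho_pos eventually_compose_filterlim[OF rho_pos tt]
    by eventually_elim (simp add: ln_div)
  ultimately have "((\<lambda>x. ln (\<rho> (t * x)) - ln (\<rho> x)) \<longlongrightarrow> \<gamma> * ln t) at_top"
    using assms by (simp add: ln_powr cong: filterlim_cong)
  from tendsto_add[OF tendsto_diff[OF filterlim_compose[OF L_minus_ln_rho tt] L_minus_ln_rho] this]
  show ?thesis by simp
qed

text \<open>The uniform convergence theorem, transported by \<open>x = exp s\<close>.\<close>

lemma L_uniform:
  assumes "\<epsilon> > 0"
  shows "\<exists>X>0. \<forall>x\<ge>X. \<forall>y\<in>{x..exp 1 * x}. \<bar>L y - L x - \<gamma> * ln (y / x)\<bar> \<le> \<epsilon>"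
proof -
  define h where "h s = L (exp s) - \<gamma> * s" for s
  have "mono (\<lambda>x. - G x)" using antimono_G by (auto simp: mono_def antimono_def)
  hence "(\<lambda>x. - (- G x)) \<in> borel_measurable borel"
    by (intro borel_measurable_uminus borel_measurable_mono)
  hence [measurable]: "G \<in> borel_measurable borel" by simp
  have [measurable]: "h \<in> borel_measurable borel" unfolding h_def L_def by measurable
  have "((\<lambda>s. h (s + u) - h s) \<longlongrightarrow> 0) at_top" for u
  proof -
    have "((\<lambda>s. L (exp u * exp s) - L (exp s) - \<gamma> * u) \<longlongrightarrow> \<gamma> * ln (exp u) - \<gamma> * u) at_top"
      by (intro tendsto_intros filterlim_compose[OF L_regular_variation exp_at_top]) auto
    thus ?thesis by (simp add: h_def exp_add algebra_simps)
  qed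
  from uniform_convergence_slowly_varying[OF \<open>h \<in> borel_measurable borel\<close> this assms] obtain S
    where S: "\<And>s u. s \<ge> S \<Longrightarrow> u \<in> {0..1} \<Longrightarrow> \<bar>h (s + u) - h s\<bar> \<le> \<epsilon>" by blast
  show ?thesis
  proof (intro exI[of _ "exp S"] conjI allI impI ballI)
    fix x y assume x: "x \<ge> exp S" and y: "y \<in> {x..exp 1 * x}"
    have pos: "x > 0" "y > 0" using x y exp_gt_zero[of S] by (auto simp del: exp_gt_zero)
    have "S \<le> ln x" using x pos by (simp add: ln_ge_iff)
    moreover have "ln (y / x) \<in> {0..1}"
      using x y by (intro ln_ratio_in_unit) (use pos in auto)
    ultimately have "\<bar>h (ln x + ln (y / x)) - h (ln x)\<bar> \<le> \<epsilon>" by (rule S)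
    moreover have "ln x + ln (y / x) = ln y" using pos by (simp add: ln_div)
    ultimately show "\<bar>L y - L x - \<gamma> * ln (y / x)\<bar> \<le> \<epsilon>"
      using pos by (simp add: h_def ln_div algebra_simps)
  qed simp
qed

text \<open>A Potter bound: an increment of \<open>L\<close> from \<open>x\<close> to \<open>y\<close> is split into steps by the factor
  \<open>exp 1\<close>, each of which costs at most a constant by the uniform estimate.\<close>

lemma L_potter_bound:
  obtains K X where "K > 0" "X > 0"
    "\<And>x y. X \<le> x \<Longrightarrow> x \<le> y \<Longrightarrow> \<bar>L y - L x\<bar> \<le> K * (1 + ln (y / x))"
proof -
  obtain X where X: "X > 0"
    "\<And>x y. x \<ge> X \<Longrightarrow> y \<in> {x..exp 1 * x} \<Longrightarrow> \<bar>L y - L x - \<gamma> * ln (y / x)\<bar> \<le> 1"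
    using L_uniform[of 1] by auto
  define K where "K = \<bar>\<gamma>\<bar> + 1"
  have K: "K > 0" by (simp add: K_def)
  have step: "\<bar>L y - L x\<bar> \<le> K" if "X \<le> x" "x \<le> y" "y \<le> exp 1 * x" for x y
  proof -
    have "x > 0" using X that by simp
    hence "\<bar>ln (y / x)\<bar> \<le> 1" using ln_ratio_in_unit[of x y] that by auto
    hence "\<bar>\<gamma> * ln (y / x)\<bar> \<le> \<bar>\<gamma>\<bar> * 1" unfolding abs_mult by (intro mult_left_mono) auto
    thus ?thesis using X(2)[of x y] that by (simp add: K_def)
  qed
  have ind: "\<bar>L y - L x\<bar> \<le> K * real n" if "X \<le> x" "x \<le> y" "y \<le> exp (real n) * x" for x y n
    using that
  proof (induction n arbitrary: y)
    case 0
    thus ?case by simp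
  next
    case (Suc n)
    have "x > 0" using X Suc by simp
    show ?case
    proof (cases "y \<le> exp 1 * x")
      case True
      hence "\<bar>L y - L x\<bar> \<le> K" using step Suc by simp
      also have "K \<le> K * real (Suc n)" using K by simp
      finally show ?thesis .
    next
      case False
      hence z: "x \<le> y / exp 1" by (simp add: pos_le_divide_eq mult.commute)
      have "y / exp 1 \<le> exp (real n) * x" using Suc.prems by (simp add: exp_add divide_le_eq mult_ac)
      hence "\<bar>L (y / exp 1) - L x\<bar> \<le> K * real n" using Suc z by blast
      moreover have "y / exp 1 \<le> y" using \<open>x > 0\<close> Suc.prems by (simp add: divide_le_eq)
      hence "\<bar>L y - L (y / exp 1)\<bar> \<le> K" by (intro step) (use z Suc.prems in auto)
      ultimately show ?thesis by (simp add: algebra_simps)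
    qed
  qed
  show ?thesis
  proof (rule that[OF K X(1)])
    fix x y assume xy: "X \<le> x" "x \<le> y"
    have pos: "x > 0" "y > 0" using X xy by auto
    define n where "n = nat \<lceil>ln (y / x)\<rceil>"
    have l0: "ln (y / x) \<ge> 0" using pos xy by simp
    have n: "ln (y / x) \<le> real n" "real n \<le> 1 + ln (y / x)" unfolding n_def using l0 by linarith+
    have "y / x \<le> exp (real n)" using n(1) pos by (metis divide_pos_pos exp_le_cancel_iff exp_ln)
    hence "y \<le> exp (real n) * x" using pos by (simp add: divide_le_eq)
    hence "\<bar>L y - L x\<bar> \<le> K * real n" using ind xy by blast
    also have "\<dots> \<le> K * (1 + ln (y / x))" using n K by (intro mult_left_mono) auto
    finally show "\<bar>L y - L x\<bar> \<le> K * (1 + ln (y / x))" .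
  qed
qed

text \<open>Changing the argument by a factor tending to 1 does not change \<open>\<rho>\<close> asymptotically. Pointwise
  regular variation does not suffice here, because the factor varies with \<open>b\<close>.\<close>

lemma L_of_asymp_argument:
  assumes f: "((\<lambda>b. f b / b) \<longlongrightarrow> 1) at_top"
  shows "((\<lambda>b. L (f b) - L b) \<longlongrightarrow> 0) at_top"
proof (rule tendstoI)
  fix e :: real assume "e > 0"
  obtain X where X: "X > 0"
    "\<And>x y. x \<ge> X \<Longrightarrow> y \<in> {x..exp 1 * x} \<Longrightarrow> \<bar>L y - L x - \<gamma> * ln (y / x)\<bar> \<le> e / 2"
    using L_uniform[of "e/2"] \<open>e > 0\<close> by auto
  have "((\<lambda>b. \<bar>\<gamma>\<bar> * \<bar>ln (f b / b)\<bar>) \<longlongrightarrow> \<bar>\<gamma>\<bar> * \<bar>ln 1\<bar>) at_top"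
    by (intro tendsto_intros f) auto
  hence "\<forall>\<^sub>F b in at_top. \<bar>\<gamma>\<bar> * \<bar>ln (f b / b)\<bar> < e / 2"
    by (rule order_tendstoD) (use \<open>e > 0\<close> in simp)
  moreover have "\<forall>\<^sub>F b in at_top. f b / b > 1 / 2" "\<forall>\<^sub>F b in at_top. f b / b < 2"
    by (rule order_tendstoD[OF f]; simp)+
  moreover have "\<forall>\<^sub>F b in at_top. b \<ge> 2 * X" by (rule eventually_ge_at_top)
  ultimately show "\<forall>\<^sub>F b in at_top. dist (L (f b) - L b) 0 < e"
  proof eventually_elim
    case (elim b)
    have b: "b > 0" using elim X by simp
    have fb: "f b > b / 2" "f b < 2 * b" using elim b by (auto simp: field_simps)
    have e2: "(2::real) \<le> exp 1" using exp_ge_add_one_self[of 1] by simp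
    have e2': "exp 1 * z \<ge> 2 * z" if "z \<ge> 0" for z :: real using e2 that by (intro mult_right_mono)
    show ?case
    proof (cases "f b \<ge> b")
      case True
      have "f b \<le> exp 1 * b" using e2'[of b] b fb by linarith
      hence "\<bar>L (f b) - L b - \<gamma> * ln (f b / b)\<bar> \<le> e / 2"
        using True b elim X by (intro X) auto
      moreover have "\<bar>\<gamma> * ln (f b / b)\<bar> < e / 2" using elim by (simp add: abs_mult)
      ultimately have "\<bar>L (f b) - L b\<bar> < e" by argo
      thus ?thesis by (simp add: dist_real_def)
    next
      case False
      have "b \<le> exp 1 * f b" using e2'[of "f b"] b fb by linarith
      hence "\<bar>L b - L (f b) - \<gamma> * ln (b / f b)\<bar> \<le> e / 2"
        using False b elim X fb by (intro X) auto
      hence "\<bar>L b - L (f b) + \<gamma> * ln (f b / b)\<bar> \<le> e / 2"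
        using b fb by (simp add: ln_div algebra_simps)
      moreover have "\<bar>\<gamma> * ln (f b / b)\<bar> < e / 2" using elim by (simp add: abs_mult)
      ultimately have "\<bar>L (f b) - L b\<bar> < e" by argo
      thus ?thesis by (simp add: dist_real_def)
    qed
  qed
qed

text \<open>By the Potter bound \<open>\<rho>\<close> eventually lies between two powers, so its logarithm is negligible against any power.\<close>

lemma L_growth:
  assumes "s > 0"
  shows "((\<lambda>x. L x / x powr s) \<longlongrightarrow> 0) at_top"
proof -
  obtain K X where KX: "K > 0" "X > 0"
    "\<And>x y. X \<le> x \<Longrightarrow> x \<le> y \<Longrightarrow> \<bar>L y - L x\<bar> \<le> K * (1 + ln (y / x))"
    using L_potter_bound by blast
  have "\<forall>\<^sub>F x in at_top. norm (L x / x powr s) \<le> (\<bar>L X\<bar> + K * (1 + ln (x / X))) / x powr s"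
    using eventually_ge_at_top[of X]
  proof eventually_elim
    case (elim x)
    have "\<bar>L x\<bar> \<le> \<bar>L X\<bar> + K * (1 + ln (x / X))" using KX(3)[of X x] elim by simp
    thus ?case by (simp add: divide_right_mono)
  qed
  moreover have "((\<lambda>x. (c + K * (1 + ln (x / X))) / x powr s) \<longlongrightarrow> 0) at_top" for c
    using KX(1,2) assms by real_asymp
  ultimately show ?thesis by (rule Lim_null_comparison)
qed

end

section \<open>The tail at the normalised points\<close>

lemma powr_second_order:
  fixes \<tau> :: real
  shows "\<exists>K. \<forall>\<^sub>F v in nhds 0. \<bar>(1 + v) powr \<tau> - 1 - \<tau> * v\<bar> \<le> K * v\<^sup>2"
proof -
  have "(\<lambda>v. (1 + v) powr \<tau> - 1 - \<tau> * v) \<in> O[at 0](\<lambda>v. v\<^sup>2)" by real_asymp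
  then obtain K where "\<forall>\<^sub>F v in at 0. norm ((1 + v) powr \<tau> - 1 - \<tau> * v) \<le> K * norm (v\<^sup>2)"
    by (elim landau_o.bigE)
  thus ?thesis by (intro exI[of _ K]) (auto simp: eventually_at_filter elim!: eventually_mono)
qed

context weibull_type_tail
begin

text \<open>The normalising sequences as functions of the real variable \<open>b = (C\<^sup>-\<^sup>1 log n)\<^sup>1\<^sup>/\<^sup>\<tau>\<close>, that is,
  with \<open>exp (C * b powr \<tau>)\<close> in the role of \<open>n\<close>.\<close>

definition mu_at :: "real \<Rightarrow> real" where "mu_at b = b + b powr (1 - \<tau>) / (C * \<tau>) * ln (\<rho> b)"
definition nu_at :: "real \<Rightarrow> real" where "nu_at b = b powr (1 - \<tau>) / (C * \<tau>)"

lemma ln_rho_growth: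
  assumes "s > 0"
  shows "((\<lambda>b. (ln (\<rho> b) + x) / b powr s) \<longlongrightarrow> 0) at_top"
proof -
  have "((\<lambda>b. L b / b powr s - (L b - ln (\<rho> b)) * (1 / b powr s) + x * (1 / b powr s)) \<longlongrightarrow> 0 - 0 * 0 + x * 0) at_top"
    by (intro tendsto_intros L_growth L_minus_ln_rho assms) (use assms in real_asymp)+
  thus ?thesis by (simp add: diff_divide_distrib add_divide_distrib)
qed

lemma nu_at_eq: "b > 0 \<Longrightarrow> nu_at b = b / (C * \<tau> * b powr \<tau>)"
  by (simp add: nu_at_def powr_diff)

lemma normalised_point_eq:
  "b > 0 \<Longrightarrow> mu_at b + nu_at b * x = b * (1 + (ln (\<rho> b) + x) / (C * \<tau> * b powr \<tau>))"
  unfolding mu_at_def nu_at_def[symmetric] nu_at_eq using C_pos \<tau>_pos by (simp add: field_simps)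

lemma normalised_point_asymp: "((\<lambda>b. (mu_at b + nu_at b * x) / b) \<longlongrightarrow> 1) at_top"
proof -
  have "((\<lambda>b. 1 + (ln (\<rho> b) + x) / b powr \<tau> / (C * \<tau>)) \<longlongrightarrow> 1 + 0 / (C * \<tau>)) at_top"
    by (intro tendsto_intros ln_rho_growth \<tau>_pos) (use C_pos \<tau>_pos in auto)
  moreover have "\<forall>\<^sub>F b in at_top. 1 + (ln (\<rho> b) + x) / b powr \<tau> / (C * \<tau>) = (mu_at b + nu_at b * x) / b"
    using eventually_gt_at_top[of 0] by eventually_elim (simp add: normalised_point_eq mult.commute[of _ "C * \<tau>"])
  ultimately show ?thesis by (simp cong: filterlim_cong)
qed

lemma at_top_of_ratio:
  assumes "((\<lambda>b. f b / b) \<longlongrightarrow> (1::real)) at_top"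
  shows "filterlim f at_top at_top"
proof -
  have "filterlim (\<lambda>b. f b / b * b) at_top at_top"
    by (rule filterlim_tendsto_pos_mult_at_top[OF assms _ filterlim_ident]) simp
  moreover have "\<forall>\<^sub>F b in at_top. f b / b * b = f b"
    using eventually_gt_at_top[of 0] by eventually_elim simp
  ultimately show ?thesis by (simp cong: filterlim_cong)
qed

text \<open>This is the heart of the limit law. With \<open>y = b * (1 + u)\<close> the exponent \<open>C * y powr \<tau>\<close> expands to
  \<open>C * b powr \<tau> + ln (\<rho> b) + x\<close> up to an error of order \<open>b powr \<tau> * u\<^sup>2\<close>, the linear term being what
  \<open>u\<close> is chosen for. Since \<open>u\<close> is of order \<open>(ln (\<rho> b) + x) / b powr \<tau>\<close> and \<open>ln (\<rho> b)\<close> is negligible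
  against \<open>b powr (\<tau>/2)\<close>, that error vanishes. The term \<open>ln (\<rho> b)\<close> cancels the factor \<open>\<rho> y\<close> of the
  tail, because \<open>y / b\<close> tends to 1.\<close>

lemma tail_at_normalised_point:
  "((\<lambda>b. exp (C * b powr \<tau>) * G (mu_at b + nu_at b * x)) \<longlongrightarrow> exp (- x)) at_top"
proof -
  define u where "u b = (ln (\<rho> b) + x) / (C * \<tau> * b powr \<tau>)" for b
  define y where "y b = mu_at b + nu_at b * x" for b
  have ratio: "((\<lambda>b. y b / b) \<longlongrightarrow> 1) at_top" unfolding y_def by (rule normalised_point_asymp)
  have y_eq: "y b = b * (1 + u b)" if "b > 0" for b
    using that by (simp add: y_def u_def normalised_point_eq)
  have u0: "(u \<longlongrightarrow> 0) at_top"
  proof -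
    have "((\<lambda>b. (ln (\<rho> b) + x) / b powr \<tau> / (C * \<tau>)) \<longlongrightarrow> 0 / (C * \<tau>)) at_top"
      by (intro tendsto_intros ln_rho_growth \<tau>_pos) (use C_pos \<tau>_pos in auto)
    thus ?thesis by (simp add: u_def[abs_def] mult.commute)
  qed
  have sq: "((\<lambda>b. b powr \<tau> * (u b)\<^sup>2) \<longlongrightarrow> 0) at_top"
  proof -
    have "((\<lambda>b. ((ln (\<rho> b) + x) / b powr (\<tau>/2) / (C * \<tau>))\<^sup>2) \<longlongrightarrow> (0 / (C * \<tau>))\<^sup>2) at_top"
      by (intro tendsto_intros ln_rho_growth) (use C_pos \<tau>_pos in auto)
    moreover have "\<forall>\<^sub>F b in at_top. ((ln (\<rho> b) + x) / b powr (\<tau>/2) / (C * \<tau>))\<^sup>2 = b powr \<tau> * (u b)\<^sup>2"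
      using eventually_gt_at_top[of 0]
    proof eventually_elim
      case (elim b)
      have "(b powr (\<tau>/2))\<^sup>2 = b powr \<tau>" using elim by (simp add: power2_eq_square flip: powr_add)
      thus ?case using elim by (simp add: u_def power_divide power_mult_distrib power2_eq_square)
    qed
    ultimately show ?thesis by (simp cong: filterlim_cong)
  qed
  obtain K where K: "\<forall>\<^sub>F v in nhds 0. \<bar>(1 + v) powr \<tau> - 1 - \<tau> * v\<bar> \<le> K * v\<^sup>2"
    using powr_second_order by blast
  have err: "((\<lambda>b. b powr \<tau> * ((1 + u b) powr \<tau> - 1 - \<tau> * u b)) \<longlongrightarrow> 0) at_top"
  proof (rule Lim_null_comparison)
    show "\<forall>\<^sub>F b in at_top. norm (b powr \<tau> * ((1 + u b) powr \<tau> - 1 - \<tau> * u b)) \<le> K * (b powr \<tau> * (u b)\<^sup>2)"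
      using eventually_compose_filterlim[OF K u0]
    proof eventually_elim
      case (elim b)
      hence "b powr \<tau> * \<bar>(1 + u b) powr \<tau> - 1 - \<tau> * u b\<bar> \<le> b powr \<tau> * (K * (u b)\<^sup>2)"
        by (intro mult_left_mono) auto
      thus ?case by (simp add: abs_mult mult_ac)
    qed
    show "((\<lambda>b. K * (b powr \<tau> * (u b)\<^sup>2)) \<longlongrightarrow> 0) at_top"
      by (rule tendsto_mult_right_zero[OF sq])
  qed
  have "((\<lambda>b. exp (- x + (L (y b) - L b) + (L b - ln (\<rho> b))
            - C * (b powr \<tau> * ((1 + u b) powr \<tau> - 1 - \<tau> * u b)))) \<longlongrightarrow> exp (- x + 0 + 0 - C * 0)) at_top"
    by (intro tendsto_intros err L_minus_ln_rho L_of_asymp_argument ratio)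
  moreover have "\<forall>\<^sub>F b in at_top. exp (- x + (L (y b) - L b) + (L b - ln (\<rho> b))
            - C * (b powr \<tau> * ((1 + u b) powr \<tau> - 1 - \<tau> * u b))) = exp (C * b powr \<tau>) * G (y b)"
    using eventually_gt_at_top[of 0] eventually_compose_filterlim[OF G_pos at_top_of_ratio[OF ratio]]
      order_tendstoD(1)[OF u0, of "-1", simplified]
  proof eventually_elim
    case (elim b)
    have "C * \<tau> * b powr \<tau> * u b = ln (\<rho> b) + x"
      using elim C_pos \<tau>_pos by (simp add: u_def)
    moreover have "y b powr \<tau> = b powr \<tau> * (1 + u b) powr \<tau>"
      using elim by (simp add: y_eq powr_mult)
    ultimately have "- x + (L (y b) - L b) + (L b - ln (\<rho> b))
            - C * (b powr \<tau> * ((1 + u b) powr \<tau> - 1 - \<tau> * u b)) = C * b powr \<tau> + (L (y b) - C * y b powr \<tau>)"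
      by (simp add: algebra_simps)
    thus ?case using elim by (simp only: exp_add flip: G_eq[of "y b"])
  qed
  ultimately show ?thesis by (simp add: y_def cong: filterlim_cong)
qed

end

section \<open>Bounds on the tail away from its centre\<close>

text \<open>Bernoulli's inequality for real exponents: \<open>1 + x\<close> is the mean of \<open>1 + a * x\<close> and \<open>1\<close> with weights
  \<open>1/a\<close> and \<open>1 - 1/a\<close>, and \<open>ln\<close> is concave.\<close>

lemma Bernoulli_powr:
  fixes x a :: real
  assumes "x > -1" "a \<ge> 1"
  shows "1 + a * x \<le> (1 + x) powr a"
proof (cases "1 + a * x > 0")
  case True
  have "(1 - 1/a) * ln 1 + 1/a * ln (1 + a * x) \<le> ln ((1 - 1/a) *\<^sub>R 1 + (1/a) *\<^sub>R (1 + a * x))"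
    by (rule concave_onD[OF ln_concave]) (use True assms in auto)
  also have "(1 - 1/a) *\<^sub>R 1 + (1/a) *\<^sub>R (1 + a * x) = 1 + x"
    using assms by (simp add: field_simps)
  finally have "ln (1 + a * x) \<le> a * ln (1 + x)" using assms by (simp add: field_simps)
  hence "exp (ln (1 + a * x)) \<le> exp (a * ln (1 + x))" by simp
  thus ?thesis using True assms by (simp add: powr_def)
next
  case False
  thus ?thesis by (meson linorder_not_less order_trans powr_ge_zero)
qed

lemma one_minus_powr_ge:
  fixes r \<tau> :: real
  assumes "0 < r" "r \<le> 1" "\<tau> > 0"
  shows "min 1 \<tau> * (1 - r) \<le> 1 - r powr \<tau>"
proof (cases "\<tau> \<ge> 1")
  case True
  have "r powr \<tau> \<le> r powr 1" using assms True by (intro powr_mono') auto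
  thus ?thesis using True assms by simp
next
  case False
  have "1 + 1/\<tau> * (r powr \<tau> - 1) \<le> (1 + (r powr \<tau> - 1)) powr (1/\<tau>)"
    by (rule Bernoulli_powr) (use assms False in auto)
  also have "\<dots> = r" using assms by (simp add: powr_powr)
  finally show ?thesis using assms False by (simp add: field_simps)
qed

context weibull_type_tail
begin

lemma G_pos_all: "G x > 0"
proof -
  obtain y where "y \<ge> x" "G y > 0"
    using eventually_happens[OF eventually_conj[OF eventually_ge_at_top[of x] G_pos]] by auto
  thus ?thesis using antimonoD[OF antimono_G, of x y] by linarith
qed

lemma G_ratio: "G y = G x * exp (L y - L x - C * (y powr \<tau> - x powr \<tau>))"
proof -
  have "G x * exp (L y - L x - C * (y powr \<tau> - x powr \<tau>))
      = exp (L x - C * x powr \<tau>) * exp (L y - L x - C * (y powr \<tau> - x powr \<tau>))"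
    using G_eq[of x] G_pos_all by simp
  also have "\<dots> = exp (L y - C * y powr \<tau>)" by (simp add: algebra_simps flip: exp_add)
  also have "\<dots> = G y" using G_eq[of y] G_pos_all by simp
  finally show ?thesis ..
qed

lemma nu_at_pos: "b > 0 \<Longrightarrow> nu_at b > 0"
  using C_pos \<tau>_pos by (simp add: nu_at_def)

lemma mu_at_asymp: "((\<lambda>b. mu_at b / b) \<longlongrightarrow> 1) at_top"
  using normalised_point_asymp[of 0] by simp

lemma mu_at_at_top: "filterlim mu_at at_top at_top"
  by (rule at_top_of_ratio[OF mu_at_asymp])

lemma nu_over_mu: "((\<lambda>b. nu_at b / mu_at b * (C * \<tau> * mu_at b powr \<tau>)) \<longlongrightarrow> 1) at_top"
proof -
  have "((\<lambda>b. (mu_at b / b) powr (\<tau> - 1)) \<longlongrightarrow> 1 powr (\<tau> - 1)) at_top"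
    by (intro tendsto_intros mu_at_asymp) auto
  moreover have "\<forall>\<^sub>F b in at_top. (mu_at b / b) powr (\<tau> - 1) = nu_at b / mu_at b * (C * \<tau> * mu_at b powr \<tau>)"
    using eventually_gt_at_top[of 0] filterlim_at_top_dense[THEN iffD1, OF mu_at_at_top, rule_format, of 0]
  proof eventually_elim
    case (elim b)
    thus ?case using C_pos \<tau>_pos by (simp add: nu_at_def powr_diff powr_divide field_simps)
  qed
  ultimately show ?thesis by (simp cong: filterlim_cong)
qed

lemma tail_at_mu:
  "\<forall>\<^sub>F b in at_top. 1/2 \<le> exp (C * b powr \<tau>) * G (mu_at b) \<and> exp (C * b powr \<tau>) * G (mu_at b) \<le> 2"
proof -
  have *: "((\<lambda>b. exp (C * b powr \<tau>) * G (mu_at b)) \<longlongrightarrow> 1) at_top"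
    using tail_at_normalised_point[of 0] by simp
  have "\<forall>\<^sub>F b in at_top. 1/2 < exp (C * b powr \<tau>) * G (mu_at b)"
    by (rule order_tendstoD[OF *]) simp
  moreover have "\<forall>\<^sub>F b in at_top. exp (C * b powr \<tau>) * G (mu_at b) < 2"
    by (rule order_tendstoD[OF *]) simp
  ultimately show ?thesis by eventually_elim simp
qed

text \<open>The conditions on \<open>b\<close> under which the two tail bounds below hold. The quantity
  \<open>C * \<tau> * mu_at b powr \<tau>\<close> is the reciprocal of the relative step \<open>nu_at b / mu_at b\<close>, up to a factor tending to 1.\<close>

lemma eventually_mu_at_large:
  "\<forall>\<^sub>F b in at_top. b > 0 \<and> mu_at b \<ge> X \<and> C * \<tau> * mu_at b powr \<tau> \<ge> N
     \<and> 1/2 \<le> nu_at b / mu_at b * (C * \<tau> * mu_at b powr \<tau>)"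
proof -
  have "filterlim (\<lambda>x. C * \<tau> * x powr \<tau>) at_top at_top"
    using C_pos \<tau>_pos by real_asymp
  hence "filterlim (\<lambda>b. C * \<tau> * mu_at b powr \<tau>) at_top at_top"
    by (rule filterlim_compose[OF _ mu_at_at_top])
  hence "\<forall>\<^sub>F b in at_top. C * \<tau> * mu_at b powr \<tau> \<ge> N" by (simp add: filterlim_at_top)
  moreover have "\<forall>\<^sub>F b in at_top. mu_at b \<ge> X" using mu_at_at_top by (simp add: filterlim_at_top)
  moreover have "\<forall>\<^sub>F b in at_top. 1/2 < nu_at b / mu_at b * (C * \<tau> * mu_at b powr \<tau>)"
    by (rule order_tendstoD[OF nu_over_mu]) simp
  ultimately show ?thesis using eventually_gt_at_top[of 0] by eventually_elim simp
qed

text \<open>Put \<open>v = (nu_at b / mu_at b) * t\<close> and \<open>N = C * \<tau> * mu_at b powr \<tau>\<close>. From \<open>(1 + v) powr \<tau> - 1 \<ge> \<tau> * ln (1 + v)\<close>, which holds for every \<open>\<tau> > 0\<close>,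
  and the Potter bound, the tail decreases at least like \<open>(1 + v) powr - (N - K)\<close> with \<open>v\<close> at least
  \<open>t / (2 * N)\<close>. As \<open>(1 + s / N) powr N\<close> increases with \<open>N\<close>, this is a bound by any fixed power of \<open>t\<close>
  once \<open>N\<close> is large; in this way concave and convex powers are treated alike.\<close>

lemma right_tail_bound:
  assumes m: "m > 0"
  shows "\<exists>A. \<forall>\<^sub>F b in at_top. \<forall>t>0. exp (C * b powr \<tau>) * G (mu_at b + nu_at b * t) \<le> A * t powr - m"
proof -
  obtain K X where KX: "K > 0" "X > 0"
    "\<And>x y. X \<le> x \<Longrightarrow> x \<le> y \<Longrightarrow> \<bar>L y - L x\<bar> \<le> K * (1 + ln (y / x))"
    using L_potter_bound by blast
  have "\<forall>\<^sub>F b in at_top. \<forall>t>0. exp (C * b powr \<tau>) * G (mu_at b + nu_at b * t) \<le> 2 * exp K * (4 * m) powr m * t powr - m"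
    using eventually_mu_at_large[of X "max (2 * K) (2 * m)"] tail_at_mu
  proof (eventually_elim, intro allI impI)
    fix b t :: real
    assume b: "b > 0 \<and> mu_at b \<ge> X \<and> C * \<tau> * mu_at b powr \<tau> \<ge> max (2 * K) (2 * m)
      \<and> 1/2 \<le> nu_at b / mu_at b * (C * \<tau> * mu_at b powr \<tau>)"
      and TG: "1/2 \<le> exp (C * b powr \<tau>) * G (mu_at b) \<and> exp (C * b powr \<tau>) * G (mu_at b) \<le> 2"
      and t: "t > 0"
    define \<mu> where "\<mu> = mu_at b"
    define N where "N = C * \<tau> * \<mu> powr \<tau>"
    define v where "v = nu_at b / \<mu> * t"
    have \<mu>: "\<mu> > 0" "\<mu> \<ge> X" using b KX by (auto simp: \<mu>_def)
    have N: "N \<ge> 2 * K" "N \<ge> 2 * m" using b by (auto simp: N_def \<mu>_def)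
    have v: "v > 0" using nu_at_pos[of b] b t \<mu> by (simp add: v_def)
    have vN: "t / 2 \<le> v * N"
    proof -
      have "1/2 * t \<le> nu_at b / \<mu> * N * t" using b t by (intro mult_right_mono) (auto simp: N_def \<mu>_def)
      thus ?thesis by (simp add: v_def mult_ac)
    qed
    have y: "mu_at b + nu_at b * t = \<mu> * (1 + v)" using \<mu> by (simp add: v_def \<mu>_def field_simps)
    have "\<mu> \<le> \<mu> * (1 + v)" using \<mu> v by simp
    hence "L (\<mu> * (1 + v)) - L \<mu> \<le> K * (1 + ln (1 + v))"
      using KX(3)[of \<mu> "\<mu> * (1 + v)"] \<mu> by simp
    moreover have "N * ln (1 + v) \<le> C * ((\<mu> * (1 + v)) powr \<tau> - \<mu> powr \<tau>)"
    proof -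
      have "1 + \<tau> * ln (1 + v) \<le> (1 + v) powr \<tau>"
        using v exp_ge_add_one_self[of "\<tau> * ln (1 + v)"] by (simp add: powr_def)
      hence "C * \<mu> powr \<tau> * (\<tau> * ln (1 + v)) \<le> C * \<mu> powr \<tau> * ((1 + v) powr \<tau> - 1)"
        using C_pos by (intro mult_left_mono) auto
      moreover have "(\<mu> * (1 + v)) powr \<tau> = \<mu> powr \<tau> * (1 + v) powr \<tau>" using \<mu> v by (simp add: powr_mult)
      ultimately show ?thesis by (simp add: N_def algebra_simps)
    qed
    ultimately have "L (\<mu> * (1 + v)) - L \<mu> - C * ((\<mu> * (1 + v)) powr \<tau> - \<mu> powr \<tau>)
        \<le> K - (N - K) * ln (1 + v)" by (simp add: algebra_simps)
    also have "\<dots> \<le> K - N / 2 * ln (1 + v)"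
      using N v by (intro diff_left_mono mult_right_mono) auto
    finally have "exp (C * b powr \<tau>) * G (mu_at b + nu_at b * t)
        \<le> (exp (C * b powr \<tau>) * G \<mu>) * exp (K - N / 2 * ln (1 + v))"
      unfolding y by (subst G_ratio[of _ \<mu>]) (auto simp: mult_ac G_pos_all less_imp_le)
    also have "\<dots> \<le> 2 * exp (K - N / 2 * ln (1 + v))"
      using TG by (intro mult_right_mono) (auto simp: \<mu>_def)
    also have "exp (K - N / 2 * ln (1 + v)) = exp K / (1 + v) powr (N / 2)"
      using v by (simp add: powr_def exp_diff)
    also have "\<dots> \<le> exp K / (t / (4 * m)) powr m"
    proof (intro divide_left_mono)
      have "t / (4 * m) \<le> 1 + N / (2 * m) * v" using vN m by (simp add: field_simps)
      also have "\<dots> \<le> (1 + v) powr (N / (2 * m))" by (rule Bernoulli_powr) (use v N m in auto)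
      finally have "(t / (4 * m)) powr m \<le> ((1 + v) powr (N / (2 * m))) powr m"
        using t m by (intro powr_mono2) auto
      thus "(t / (4 * m)) powr m \<le> (1 + v) powr (N / 2)" using m by (simp add: powr_powr)
    qed (use t m v in auto)
    also have "exp K / (t / (4 * m)) powr m = exp K * (4 * m) powr m * t powr - m"
      using t m by (simp add: powr_divide powr_minus field_simps)
    finally show "exp (C * b powr \<tau>) * G (mu_at b + nu_at b * t) \<le> 2 * exp K * (4 * m) powr m * t powr - m"
      by (simp add: mult_ac)
  qed
  thus ?thesis by blast
qed

text \<open>Down to \<open>mu_at b / 2\<close> the Potter bound costs a constant only, and \<open>1 - r powr \<tau> \<ge> min 1 \<tau> * (1 - r)\<close> makes the
  exponent grow linearly in \<open>t\<close>. Below that point monotonicity keeps the value reached there, which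
  amounts to dividing the rate by 6, since the range allowed for \<open>t\<close> is six times as long.\<close>

lemma left_tail_growth:
  "\<exists>c>0. \<exists>d>0. \<forall>\<^sub>F b in at_top. \<forall>t\<ge>0. nu_at b * t \<le> 3 * mu_at b \<longrightarrow>
     c * exp (d * t) \<le> exp (C * b powr \<tau>) * G (mu_at b - nu_at b * t)"
proof -
  obtain K X where KX: "K > 0" "X > 0"
    "\<And>x y. X \<le> x \<Longrightarrow> x \<le> y \<Longrightarrow> \<bar>L y - L x\<bar> \<le> K * (1 + ln (y / x))"
    using L_potter_bound by blast
  define c where "c = 1/2 * exp (- K * (1 + ln 2))"
  define d where "d = min 1 \<tau> / (2 * \<tau>)"
  have cd: "c > 0" "d > 0" using \<tau>_pos by (auto simp: c_def d_def)
  have "\<forall>\<^sub>F b in at_top. \<forall>t\<ge>0. nu_at b * t \<le> 3 * mu_at b \<longrightarrow>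
     c * exp (d / 6 * t) \<le> exp (C * b powr \<tau>) * G (mu_at b - nu_at b * t)"
    using eventually_mu_at_large[of "2 * X" 0] tail_at_mu
  proof (eventually_elim, intro allI impI)
    fix b t :: real
    assume b: "b > 0 \<and> mu_at b \<ge> 2 * X \<and> C * \<tau> * mu_at b powr \<tau> \<ge> 0
      \<and> 1/2 \<le> nu_at b / mu_at b * (C * \<tau> * mu_at b powr \<tau>)"
      and TG: "1/2 \<le> exp (C * b powr \<tau>) * G (mu_at b) \<and> exp (C * b powr \<tau>) * G (mu_at b) \<le> 2"
      and t: "t \<ge> 0" "nu_at b * t \<le> 3 * mu_at b"
    define \<mu> where "\<mu> = mu_at b"
    define N where "N = C * \<tau> * \<mu> powr \<tau>"
    have \<mu>: "\<mu> > 0" "\<mu> \<ge> 2 * X" using b KX by (auto simp: \<mu>_def)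
    have s0: "nu_at b > 0" using b nu_at_pos by auto
    define s where "s = min t (\<mu> / (2 * nu_at b))"
    have s: "s \<ge> 0" "s \<le> t" "nu_at b * s \<le> \<mu> / 2" "t / 6 \<le> s"
      using t s0 \<mu> by (auto simp: s_def \<mu>_def min_def field_simps)
    define r where "r = 1 - nu_at b / \<mu> * s"
    have y: "\<mu> - nu_at b * s = \<mu> * r" using \<mu> by (simp add: r_def field_simps)
    have r: "1/2 \<le> r" "r \<le> 1" using s s0 \<mu> by (auto simp: r_def field_simps)
    have "\<bar>L \<mu> - L (\<mu> * r)\<bar> \<le> K * (1 + ln (\<mu> / (\<mu> * r)))"
    proof (rule KX)
      have "\<mu> * (1/2) \<le> \<mu> * r" using \<mu> r by (intro mult_left_mono) auto
      thus "X \<le> \<mu> * r" using \<mu>(2) by argo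
    qed (use \<mu> r in auto)
    also have "\<dots> \<le> K * (1 + ln 2)"
      using \<mu> r KX by (intro mult_left_mono add_left_mono) (auto simp: field_simps)
    finally have "- K * (1 + ln 2) \<le> L (\<mu> * r) - L \<mu>" by simp
    moreover have "d * s \<le> C * (\<mu> powr \<tau> - (\<mu> * r) powr \<tau>)"
    proof -
      have "1/2 * s \<le> nu_at b / \<mu> * N * s" using b s by (intro mult_right_mono) (auto simp: N_def \<mu>_def)
      also have "\<dots> = N * (1 - r)" by (simp add: r_def)
      finally have "min 1 \<tau> * (1/2 * s) \<le> min 1 \<tau> * (N * (1 - r))"
        using \<tau>_pos by (intro mult_left_mono) auto
      hence "\<tau> * (d * s) \<le> N * (min 1 \<tau> * (1 - r))" using \<tau>_pos by (simp add: d_def mult_ac)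
      also have "\<dots> \<le> N * (1 - r powr \<tau>)"
        using r b \<tau>_pos by (intro mult_left_mono one_minus_powr_ge) (auto simp: N_def \<mu>_def)
      also have "\<dots> = \<tau> * (C * (\<mu> powr \<tau> - (\<mu> * r) powr \<tau>))"
        using r \<mu> by (simp add: N_def powr_mult algebra_simps)
      finally show ?thesis using \<tau>_pos by simp
    qed
    ultimately have "- K * (1 + ln 2) + d * s \<le> L (\<mu> * r) - L \<mu> - C * ((\<mu> * r) powr \<tau> - \<mu> powr \<tau>)"
      by (simp add: algebra_simps)
    hence "1/2 * exp (- K * (1 + ln 2) + d * s)
        \<le> (exp (C * b powr \<tau>) * G \<mu>) * exp (L (\<mu> * r) - L \<mu> - C * ((\<mu> * r) powr \<tau> - \<mu> powr \<tau>))"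
      using TG by (intro mult_mono) (auto simp: \<mu>_def)
    also have "\<dots> = exp (C * b powr \<tau>) * G (\<mu> - nu_at b * s)"
      unfolding y by (subst G_ratio[of "\<mu> * r" \<mu>]) simp
    also have "\<dots> \<le> exp (C * b powr \<tau>) * G (mu_at b - nu_at b * t)"
      using s s0 by (intro mult_left_mono antimonoD[OF antimono_G]) (auto simp: \<mu>_def)
    finally have "c * exp (d * s) \<le> exp (C * b powr \<tau>) * G (mu_at b - nu_at b * t)"
      by (simp add: c_def mult_ac flip: exp_add)
    moreover have "c * exp (d / 6 * t) \<le> c * exp (d * s)"
      using s cd by (simp add: field_simps)
    ultimately show "c * exp (d / 6 * t) \<le> exp (C * b powr \<tau>) * G (mu_at b - nu_at b * t)" by linarith
  qed
  thus ?thesis using cd by (intro exI[of _ c] exI[of _ "d/6"] conjI) auto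
qed

end

section \<open>Order statistics and the binomial distribution\<close>

text \<open>The probability that a binomial variable with parameters \<open>n\<close> and \<open>p\<close> is less than \<open>k\<close>.\<close>

definition binomial_lt :: "nat \<Rightarrow> nat \<Rightarrow> real \<Rightarrow> real" where
  "binomial_lt k n p = (\<Sum>j<k. real (n choose j) * p ^ j * (1 - p) ^ (n - j))"

lemma nth_sort_le_iff:
  fixes xs :: "real list"
  assumes "i < length xs"
  shows "sort xs ! i \<le> y \<longleftrightarrow> i < length (filter (\<lambda>x. x \<le> y) xs)"
proof -
  have sorted: "zs ! i \<le> y \<longleftrightarrow> i < length (filter (\<lambda>x. x \<le> y) zs)" if "sorted zs" "i < length zs" for zs i
    using that
  proof (induction zs arbitrary: i)
    case (Cons z zs)
    show ?case
    proof (cases "z \<le> y")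
      case True
      thus ?thesis using Cons by (cases i) auto
    next
      case False
      hence all: "\<forall>x\<in>set (z # zs). \<not> x \<le> y" using Cons.prems by auto
      hence "filter (\<lambda>x. x \<le> y) (z # zs) = []" unfolding filter_empty_conv .
      hence "\<not> i < length (filter (\<lambda>x. x \<le> y) (z # zs))" by (simp only: list.size not_less_zero) simp
      moreover have "\<not> (z # zs) ! i \<le> y" using all nth_mem[OF Cons.prems(2)] by blast
      ultimately show ?thesis by blast
    qed
  qed simp
  have "length (filter (\<lambda>x. x \<le> y) (sort xs)) = length (filter (\<lambda>x. x \<le> y) xs)"
    by (simp add: filter_sort)
  thus ?thesis using sorted[of "sort xs" i] assms by simp
qed

lemma kth_largest_le_iff:
  assumes "1 \<le> k" "k \<le> length xs"
  shows "kth_largest k xs \<le> y \<longleftrightarrow> length (filter (\<lambda>x. y < x) xs) < k"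
proof -
  have "length (filter (\<lambda>x. y < x) xs) + length (filter (\<lambda>x. x \<le> y) xs) = length xs"
    using sum_length_filter_compl[of "\<lambda>x. y < x" xs] by (simp add: not_less)
  moreover have "kth_largest k xs = sort xs ! (length xs - k)"
    using assms by (simp add: kth_largest_def rev_nth)
  ultimately show ?thesis using nth_sort_le_iff[of "length xs - k" xs y] assms by auto
qed

lemma order_stat_le_iff:
  assumes "1 \<le> k" "k \<le> n"
  shows "order_stat Y k n \<omega> \<le> y \<longleftrightarrow> card {i\<in>{1..n}. y < Y i \<omega>} < k"
proof -
  have "length (filter (\<lambda>x. y < x) (map (\<lambda>i. Y i \<omega>) [1..<Suc n])) = card {i\<in>{1..n}. y < Y i \<omega>}"
    by (simp only: filter_map length_map o_def distinct_length_filter[OF distinct_upt] set_upt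
        atLeastLessThanSuc_atLeastAtMost Int_def) (auto intro!: arg_cong[where f=card])
  thus ?thesis unfolding order_stat_def using kth_largest_le_iff[of k "map (\<lambda>i. Y i \<omega>) [1..<Suc n]" y] assms by simp
qed

text \<open>The event is split according to the exact set \<open>J\<close> of indices that exceed \<open>y\<close>; for each \<open>J\<close>
  independence applies to the half lines on either side of \<open>y\<close>.\<close>

lemma (in prob_space) prob_card_exceedances:
  fixes Y :: "nat \<Rightarrow> 'a \<Rightarrow> real" and y :: real
  assumes ind: "indep_vars (\<lambda>_. borel) Y {1..}"
    and id: "\<forall>i\<ge>1. distr M borel (Y i) = distr M borel (Y 1)"
    and n: "n \<ge> 1"
    and p_def: "p = \<P>(\<omega> in M. y < Y 1 \<omega>)"
  shows "\<P>(\<omega> in M. card {i\<in>{1..n}. y < Y i \<omega>} < k) = binomial_lt k n p"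
proof -
  have [measurable]: "Y i \<in> borel_measurable M" if "i \<in> {1..}" for i
    using ind that by (auto simp: indep_vars_def)
  have pY: "prob (Y i -` {y<..} \<inter> space M) = p" "prob (Y i -` {..y} \<inter> space M) = 1 - p"
    if i: "i \<in> {1..}" for i
  proof -
    have eq: "prob (Y i -` S \<inter> space M) = prob (Y 1 -` S \<inter> space M)" if "S \<in> sets borel" for S
    proof -
      have "prob (Y i -` S \<inter> space M) = measure (distr M borel (Y i)) S"
        using i that by (simp add: measure_distr)
      also have "distr M borel (Y i) = distr M borel (Y 1)" using id i by blast
      also have "measure (distr M borel (Y 1)) S = prob (Y 1 -` S \<inter> space M)"
        using that by (simp add: measure_distr)
      finally show ?thesis .
    qed
    show "prob (Y i -` {y<..} \<inter> space M) = p"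
      unfolding p_def by (subst eq) (auto intro!: arg_cong[where f=prob])
    moreover have "Y i -` {..y} \<inter> space M = space M - (Y i -` {y<..} \<inter> space M)" by auto
    ultimately show "prob (Y i -` {..y} \<inter> space M) = 1 - p"
      using i by (simp add: prob_compl)
  qed
  define B where "B J = (\<Inter>i\<in>{1..n}. Y i -` (if i \<in> J then {y<..} else {..y}) \<inter> space M)" for J
  have B_sets [measurable]: "B J \<in> events" for J
    unfolding B_def using n by (intro sets.finite_INT) auto
  have B_prob: "prob (B J) = p ^ card J * (1 - p) ^ (n - card J)" if J: "J \<subseteq> {1..n}" for J
  proof -
    have "prob (B J) = (\<Prod>i\<in>{1..n}. prob (Y i -` (if i \<in> J then {y<..} else {..y}) \<inter> space M))"
      unfolding B_def using n by (intro indep_varsD[OF ind]) auto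
    also have "\<dots> = (\<Prod>i\<in>{1..n}. if i \<in> J then p else 1 - p)"
      by (intro prod.cong refl) (auto simp: pY)
    also have "\<dots> = (\<Prod>i\<in>J. p) * (\<Prod>i\<in>{1..n} - J. 1 - p)"
      by (subst prod.If_cases) (use J in \<open>auto simp: Int_absorb1 Diff_eq\<close>)
    finally show ?thesis using J by (simp add: card_Diff_subset finite_subset)
  qed
  have B_eq: "\<omega> \<in> B J \<longleftrightarrow> \<omega> \<in> space M \<and> {i\<in>{1..n}. y < Y i \<omega>} = J" if "J \<subseteq> {1..n}" for J \<omega>
    using that n unfolding B_def by (auto split: if_splits) (metis atLeastAtMost_iff not_less subsetD)+
  have "{\<omega>\<in>space M. card {i\<in>{1..n}. y < Y i \<omega>} < k} = (\<Union>J\<in>{J. J \<subseteq> {1..n} \<and> card J < k}. B J)"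
    using B_eq by auto
  also have "prob \<dots> = (\<Sum>J\<in>{J. J \<subseteq> {1..n} \<and> card J < k}. prob (B J))"
    by (intro finite_measure_finite_Union) (use B_eq in \<open>auto simp: disjoint_family_on_def\<close>)
  also have "{J. J \<subseteq> {1..n} \<and> card J < k} = (\<Union>j<k. {J. J \<subseteq> {1..n} \<and> card J = j})" by auto
  also have "(\<Sum>J\<in>\<dots>. prob (B J)) = (\<Sum>j<k. \<Sum>J\<in>{J. J \<subseteq> {1..n} \<and> card J = j}. prob (B J))"
    by (rule sum.UNION_disjoint) auto
  also have "\<dots> = (\<Sum>j<k. \<Sum>J\<in>{J. J \<subseteq> {1..n} \<and> card J = j}. p ^ j * (1 - p) ^ (n - j))"
    by (intro sum.cong refl) (auto simp: B_prob)
  finally show ?thesis by (simp add: binomial_lt_def n_subsets mult.assoc)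
qed

lemma binomial_term_le_1:
  assumes "0 \<le> p" "p \<le> (1::real)"
  shows "real (n choose j) * p ^ j * (1 - p) ^ (n - j) \<le> 1"
proof (cases "j \<le> n")
  case True
  have "real (n choose j) * p ^ j * (1 - p) ^ (n - j) \<le> (\<Sum>i\<le>n. real (n choose i) * p ^ i * (1 - p) ^ (n - i))"
    using assms True by (intro member_le_sum) auto
  also have "\<dots> = 1" using binomial_ring[of p "1 - p" n] by simp
  finally show ?thesis .
qed (simp add: binomial_eq_0)

text \<open>Multiplying the weight of \<open>j\<close> among \<open>n\<close> trials by \<open>(n + 1) * p\<close> gives \<open>j + 1\<close> times the weight
  of \<open>j + 1\<close> among \<open>n + 1\<close> trials, and a weight is at most 1.\<close>

lemma binomial_lt_bound:
  assumes "0 < p" "p \<le> 1" "n > 0"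
  shows "binomial_lt k n p \<le> real k ^ 2 / (real n * p)"
proof -
  have "real (n choose j) * p ^ j * (1 - p) ^ (n - j) \<le> real k / (real n * p)" if "j < k" for j
  proof -
    have "real n * p * (real (n choose j) * p ^ j * (1 - p) ^ (n - j))
        \<le> real (Suc n) * p * (real (n choose j) * p ^ j * (1 - p) ^ (n - j))"
      using assms by (intro mult_right_mono) auto
    also have "\<dots> = real (Suc n * (n choose j)) * p ^ Suc j * (1 - p) ^ (Suc n - Suc j)"
      by (simp only: of_nat_mult power_Suc diff_Suc_Suc mult_ac)
    also have "Suc n * (n choose j) = Suc j * (Suc n choose Suc j)" by (simp only: Suc_times_binomial_eq mult.commute)
    also have "real (Suc j * (Suc n choose Suc j)) * p ^ Suc j * (1 - p) ^ (Suc n - Suc j)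
        = real (Suc j) * (real (Suc n choose Suc j) * p ^ Suc j * (1 - p) ^ (Suc n - Suc j))"
      by (simp only: of_nat_mult mult_ac)
    also have "\<dots> \<le> real (Suc j) * 1"
      by (intro mult_left_mono binomial_term_le_1) (use assms in auto)
    also have "\<dots> \<le> real k" using that by simp
    finally show ?thesis using assms by (simp add: pos_le_divide_eq mult_ac)
  qed
  hence "binomial_lt k n p \<le> (\<Sum>j<k. real k / (real n * p))" unfolding binomial_lt_def by (intro sum_mono) auto
  thus ?thesis by (simp add: power2_eq_square)
qed

lemma binomial_lt_bound_small_complement:
  assumes "0 \<le> p" "p \<le> 1" "k \<le> n" "n > 0"
  shows "binomial_lt k n p \<le> real k * real n ^ k * (1 - p) ^ (n - k)"
proof -
  have "real (n choose j) * p ^ j * (1 - p) ^ (n - j) \<le> real n ^ k * (1 - p) ^ (n - k)" if "j < k" for j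
  proof -
    have "real (n choose j) * p ^ j \<le> real n ^ j * 1"
      using assms that binomial_le_pow[of j n] by (intro mult_mono power_le_one) (auto simp flip: of_nat_power)
    also have "\<dots> \<le> real n ^ k" using assms that by (simp add: power_increasing)
    finally show ?thesis using assms that by (intro mult_mono power_decreasing) auto
  qed
  hence "binomial_lt k n p \<le> (\<Sum>j<k. real n ^ k * (1 - p) ^ (n - k))" unfolding binomial_lt_def by (intro sum_mono) auto
  thus ?thesis by simp
qed

text \<open>The factor \<open>(n choose j) * p ^ j\<close> is the product of \<open>n * p - i * p\<close> over \<open>i < j\<close>, divided by \<open>fact j\<close>, so only
  the limits of \<open>n * p n\<close> and \<open>p n\<close> enter.\<close>

lemma binomial_lt_poisson_limit:
  fixes p :: "nat \<Rightarrow> real"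
  assumes lim: "(\<lambda>n. real n * p n) \<longlonglongrightarrow> \<theta>"
  shows "(\<lambda>n. binomial_lt k n (p n)) \<longlonglongrightarrow> (\<Sum>j<k. \<theta> ^ j / fact j * exp (- \<theta>))"
  unfolding binomial_lt_def
proof (intro tendsto_sum)
  fix j
  have p0: "p \<longlonglongrightarrow> 0"
  proof -
    have "(\<lambda>n. real n * p n * (1 / real n)) \<longlonglongrightarrow> \<theta> * 0" by (intro tendsto_intros lim lim_1_over_n)
    moreover have "\<forall>\<^sub>F n in sequentially. real n * p n * (1 / real n) = p n"
      using eventually_gt_at_top[of 0] by eventually_elim simp
    ultimately show ?thesis by (simp cong: filterlim_cong)
  qed
  have choose: "(\<lambda>n. real (n choose j) * p n ^ j) \<longlonglongrightarrow> \<theta> ^ j / fact j"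
  proof -
    have "(\<lambda>n. (\<Prod>i<j. real n * p n - real i * p n) / fact j) \<longlonglongrightarrow> (\<Prod>i<j. \<theta> - real i * 0) / fact j"
      by (intro tendsto_intros lim p0) auto
    moreover have "(\<Prod>i<j. real n * p n - real i * p n) / fact j = real (n choose j) * p n ^ j" for n
    proof -
      have "(\<Prod>i<j. real n * p n - real i * p n) = (\<Prod>i<j. (real n - real i) * p n)"
        by (simp add: algebra_simps)
      also have "\<dots> = (\<Prod>i<j. real n - real i) * p n ^ j" by (simp add: prod.distrib)
      finally show ?thesis by (simp add: binomial_gbinomial gbinomial_prod_rev lessThan_atLeast0)
    qed
    ultimately show ?thesis by simp
  qed
  have small: "\<forall>\<^sub>F n in sequentially. \<bar>p n\<bar> < 1/2"
    using tendstoD[OF p0, of "1/2"] by (simp add: dist_real_def)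
  have power: "(\<lambda>n. (1 - p n) ^ n) \<longlonglongrightarrow> exp (- \<theta>)"
  proof -
    have "(\<lambda>n. real n * (ln (1 - p n) + p n)) \<longlonglongrightarrow> 0"
    proof (rule Lim_null_comparison)
      show "\<forall>\<^sub>F n in sequentially. norm (real n * (ln (1 - p n) + p n)) \<le> 2 * (\<bar>real n * p n\<bar> * \<bar>p n\<bar>)"
        using small
      proof eventually_elim
        case (elim n)
        have "\<bar>ln (1 + - p n) - - p n\<bar> \<le> 2 * (- p n)\<^sup>2"
          by (rule abs_ln_one_plus_x_minus_x_bound) (use elim in simp)
        hence "real n * \<bar>ln (1 - p n) + p n\<bar> \<le> real n * (2 * (\<bar>p n\<bar> * \<bar>p n\<bar>))"
          by (intro mult_left_mono) (auto simp: power2_eq_square)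
        thus ?case by (simp add: abs_mult mult_ac)
      qed
      have "(\<lambda>n. 2 * (\<bar>real n * p n\<bar> * \<bar>p n\<bar>)) \<longlonglongrightarrow> 2 * (\<bar>\<theta>\<bar> * \<bar>0\<bar>)"
        by (intro tendsto_intros lim p0)
      thus "(\<lambda>n. 2 * (\<bar>real n * p n\<bar> * \<bar>p n\<bar>)) \<longlonglongrightarrow> 0" by simp
    qed
    hence "(\<lambda>n. exp (real n * (ln (1 - p n) + p n) - real n * p n)) \<longlonglongrightarrow> exp (0 - \<theta>)"
      by (intro tendsto_intros lim)
    moreover have "\<forall>\<^sub>F n in sequentially. exp (real n * (ln (1 - p n) + p n) - real n * p n) = (1 - p n) ^ n"
      using small
    proof eventually_elim
      case (elim n)
      have "exp (real n * (ln (1 - p n) + p n) - real n * p n) = exp (ln (1 - p n)) ^ n"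
        by (simp add: algebra_simps flip: exp_of_nat_mult)
      thus ?case using elim by simp
    qed
    ultimately show ?thesis by (simp cong: filterlim_cong)
  qed
  have "(\<lambda>n. real (n choose j) * p n ^ j * ((1 - p n) ^ n / (1 - p n) ^ j)) \<longlonglongrightarrow> \<theta> ^ j / fact j * (exp (- \<theta>) / (1 - 0) ^ j)"
    by (intro tendsto_intros choose power p0) auto
  moreover have "\<forall>\<^sub>F n in sequentially. real (n choose j) * p n ^ j * ((1 - p n) ^ n / (1 - p n) ^ j)
      = real (n choose j) * p n ^ j * (1 - p n) ^ (n - j)"
    using small eventually_ge_at_top[of j] by eventually_elim (simp add: power_diff)
  ultimately show "(\<lambda>n. real (n choose j) * p n ^ j * (1 - p n) ^ (n - j)) \<longlonglongrightarrow> \<theta> ^ j / fact j * exp (- \<theta>)"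
    using Lim_transform_eventually by fastforce
qed

section \<open>Convergence of moments from a uniform tail bound\<close>

lemma (in prob_space) nn_integral_layer_cake:
  assumes [measurable]: "X \<in> borel_measurable M" and nn: "\<And>\<omega>. X \<omega> \<ge> 0"
  shows "(\<integral>\<^sup>+\<omega>. ennreal (X \<omega>) \<partial>M) = (\<integral>\<^sup>+t. indicator {0..} t * ennreal (\<P>(\<omega> in M. t < X \<omega>)) \<partial>lborel)"
proof -
  interpret pair_sigma_finite M lborel ..
  define f :: "'a \<Rightarrow> real \<Rightarrow> ennreal" where "f \<omega> t = indicator {0..} t * (if t < X \<omega> then 1 else 0)" for \<omega> t
  have [measurable]: "case_prod f \<in> borel_measurable (M \<Otimes>\<^sub>M lborel)" unfolding f_def by measurable
  have "(\<integral>\<^sup>+\<omega>. ennreal (X \<omega>) \<partial>M) = (\<integral>\<^sup>+\<omega>. (\<integral>\<^sup>+t. f \<omega> t \<partial>lborel) \<partial>M)"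
  proof (intro nn_integral_cong)
    fix \<omega>
    have "(\<integral>\<^sup>+t. f \<omega> t \<partial>lborel) = (\<integral>\<^sup>+t. indicator {0..<X \<omega>} t \<partial>lborel)"
      by (intro nn_integral_cong) (auto simp: f_def indicator_def)
    also have "\<dots> = ennreal (X \<omega>)" using nn[of \<omega>] by simp
    finally show "ennreal (X \<omega>) = (\<integral>\<^sup>+t. f \<omega> t \<partial>lborel)" ..
  qed
  also have "\<dots> = (\<integral>\<^sup>+t. (\<integral>\<^sup>+\<omega>. f \<omega> t \<partial>M) \<partial>lborel)"
    by (rule Fubini'[symmetric]) measurable
  also have "\<dots> = (\<integral>\<^sup>+t. indicator {0..} t * ennreal (\<P>(\<omega> in M. t < X \<omega>)) \<partial>lborel)"
  proof (intro nn_integral_cong)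
    fix t
    have "(\<integral>\<^sup>+\<omega>. f \<omega> t \<partial>M) = indicator {0..} t * (\<integral>\<^sup>+\<omega>. (if t < X \<omega> then 1 else 0) \<partial>M)"
      unfolding f_def by (rule nn_integral_cmult) measurable
    also have "(\<integral>\<^sup>+\<omega>. (if t < X \<omega> then 1 else 0) \<partial>M) = (\<integral>\<^sup>+\<omega>. indicator {\<omega>\<in>space M. t < X \<omega>} \<omega> \<partial>M)"
      by (intro nn_integral_cong) (auto simp: indicator_def)
    also have "\<dots> = ennreal (\<P>(\<omega> in M. t < X \<omega>))" by (simp add: emeasure_eq_measure)
    finally show "(\<integral>\<^sup>+\<omega>. f \<omega> t \<partial>M) = indicator {0..} t * ennreal (\<P>(\<omega> in M. t < X \<omega>))" .
  qed
  finally show ?thesis .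
qed

lemma less_powr_iff:
  fixes t z p :: real
  assumes "t \<ge> 0" "z \<ge> 0" "p > 0"
  shows "t < z powr p \<longleftrightarrow> t powr (1/p) < z"
proof
  assume "t < z powr p"
  hence "t powr (1/p) < (z powr p) powr (1/p)" using assms by (intro powr_less_mono2) auto
  thus "t powr (1/p) < z" using assms by (simp add: powr_powr)
next
  assume "t powr (1/p) < z"
  hence "(t powr (1/p)) powr p < z powr p" using assms by (intro powr_less_mono2) auto
  thus "t < z powr p" using assms by (simp add: powr_powr)
qed

text \<open>By the portmanteau theorem: the boundary of \<open>{z. s < \<bar>z\<bar>}\<close> has at most the two points \<open>s\<close> and
  \<open>- s\<close>, which have no mass in the limit.\<close>

lemma tail_prob_abs_converges:
  fixes Z :: "nat \<Rightarrow> 'a \<Rightarrow> real" and W :: "'b \<Rightarrow> real"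
  assumes M: "prob_space M" and N: "prob_space N"
    and [measurable]: "\<And>n. Z n \<in> borel_measurable M" "W \<in> borel_measurable N"
    and cdf: "\<And>x. (\<lambda>n. \<P>(\<omega> in M. Z n \<omega> \<le> x)) \<longlonglongrightarrow> \<P>(\<omega> in N. W \<omega> \<le> x)"
    and atomless: "\<And>x. \<P>(\<omega> in N. W \<omega> = x) = 0"
  shows "(\<lambda>n. \<P>(\<omega> in M. s < \<bar>Z n \<omega>\<bar>)) \<longlonglongrightarrow> \<P>(\<omega> in N. s < \<bar>W \<omega>\<bar>)"
proof -
  interpret M: prob_space M by fact
  interpret N: prob_space N by fact
  define D where "D n = distr M borel (Z n)" for n
  define E where "E = distr N borel W"
  have meas_D: "measure (D n) {x. P x} = \<P>(\<omega> in M. P (Z n \<omega>))" if "{x. P x} \<in> sets borel" for P n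
    using that by (simp add: D_def measure_distr) (auto intro!: arg_cong[where f="measure M"])
  have meas_E: "measure E {x. P x} = \<P>(\<omega> in N. P (W \<omega>))" if "{x. P x} \<in> sets borel" for P
    using that by (simp add: E_def measure_distr) (auto intro!: arg_cong[where f="measure N"])
  have rD: "real_distribution (D n)" for n unfolding D_def by simp
  have rE: "real_distribution E" unfolding E_def by simp
  interpret E: real_distribution E by (rule rE)
  have "weak_conv_m D E"
    unfolding weak_conv_m_def weak_conv_def cdf_def
    using cdf meas_D[of "\<lambda>z. z \<le> x" for x] meas_E[of "\<lambda>z. z \<le> x" for x] by (simp add: atMost_def)
  moreover have "emeasure E (frontier {z. s < \<bar>z\<bar>}) = 0"
  proof -
    have E0: "emeasure E {x} = 0" for x
      using meas_E[of "\<lambda>z. z = x"] atomless[of x] by (simp add: E.emeasure_eq_measure)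
    have "closed {z. s \<le> \<bar>z\<bar>}"
      by (auto intro!: closed_Collect_le continuous_intros)
    hence "closure {z. s < \<bar>z\<bar>} \<subseteq> {z. s \<le> \<bar>z\<bar>}" by (intro closure_minimal) auto
    moreover have "open {z. s < \<bar>z\<bar>}" by (auto intro!: open_Collect_less continuous_intros)
    ultimately have "frontier {z. s < \<bar>z\<bar>} \<subseteq> {s} \<union> {-s}"
      by (auto simp: frontier_def interior_open)
    hence "emeasure E (frontier {z. s < \<bar>z\<bar>}) \<le> emeasure E ({s} \<union> {-s})"
      by (intro emeasure_mono) (simp_all add: E_def)
    also have "\<dots> \<le> emeasure E {s} + emeasure E {-s}"
      by (intro emeasure_subadditive) (simp_all add: E_def)
    finally show ?thesis by (simp add: E0)
  qed
  ultimately have "(\<lambda>n. measure (D n) {z. s < \<bar>z\<bar>}) \<longlonglongrightarrow> measure E {z. s < \<bar>z\<bar>}"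
    by (intro weak_conv_imp_continuity_set_conv rD rE) auto
  thus ?thesis using meas_D[of "\<lambda>z. s < \<bar>z\<bar>"] meas_E[of "\<lambda>z. s < \<bar>z\<bar>"] by simp
qed

text \<open>Convergence in distribution gives convergence of \<open>P(\<bar>Z\<^sub>n\<bar> > s)\<close> for each \<open>s\<close>. The moment is the integral of
  \<open>P(\<bar>Z\<^sub>n\<bar> > t powr (1/p))\<close> over \<open>t \<ge> 0\<close>, and the tail bound dominates the integrand by 1 on \<open>[0, 1]\<close> and by a
  multiple of \<open>t powr (- m / p)\<close> beyond, which is integrable because \<open>p < m\<close>. The same majorant
  bounds the limit, whence its integrability.\<close>

lemma absolute_moments_converge:
  fixes Z :: "nat \<Rightarrow> 'a \<Rightarrow> real" and W :: "'b \<Rightarrow> real"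
  assumes M: "prob_space M" and N: "prob_space N"
    and Z [measurable]: "\<And>n. Z n \<in> borel_measurable M" and W [measurable]: "W \<in> borel_measurable N"
    and cdf: "\<And>x. (\<lambda>n. \<P>(\<omega> in M. Z n \<omega> \<le> x)) \<longlonglongrightarrow> \<P>(\<omega> in N. W \<omega> \<le> x)"
    and atomless: "\<And>x. \<P>(\<omega> in N. W \<omega> = x) = 0"
    and p: "p > 0" "p < m"
    and bound: "\<forall>\<^sub>F n in sequentially. \<forall>s\<ge>1. \<P>(\<omega> in M. s < \<bar>Z n \<omega>\<bar>) \<le> A * s powr - m"
  shows "(\<forall>\<^sub>F n in sequentially. integrable M (\<lambda>\<omega>. \<bar>Z n \<omega>\<bar> powr p)) \<and>
    integrable N (\<lambda>\<omega>. \<bar>W \<omega>\<bar> powr p) \<and>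
    (\<lambda>n. prob_space.expectation M (\<lambda>\<omega>. \<bar>Z n \<omega>\<bar> powr p)) \<longlonglongrightarrow> prob_space.expectation N (\<lambda>\<omega>. \<bar>W \<omega>\<bar> powr p)"
proof -
  interpret M: prob_space M by fact
  interpret N: prob_space N by fact
  from bound obtain n0 where n0:
    "\<And>n s. n \<ge> n0 \<Longrightarrow> s \<ge> 1 \<Longrightarrow> \<P>(\<omega> in M. s < \<bar>Z n \<omega>\<bar>) \<le> A * s powr - m"
    by (auto simp: eventually_sequentially)
  define q where "q n t = \<P>(\<omega> in M. t powr (1/p) < \<bar>Z n \<omega>\<bar>)" for n t
  define r where "r t = \<P>(\<omega> in N. t powr (1/p) < \<bar>W \<omega>\<bar>)" for t
  define w :: "real \<Rightarrow> ennreal" where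
    "w t = indicator {0..1} t + ennreal A * (indicator {1..} t * ennreal (t powr (- m / p)))" for t
  have cake_Z: "(\<integral>\<^sup>+\<omega>. ennreal (\<bar>Z n \<omega>\<bar> powr p) \<partial>M) = (\<integral>\<^sup>+t. indicator {0..} t * ennreal (q n t) \<partial>lborel)" for n
    unfolding q_def using p
    by (subst M.nn_integral_layer_cake) (auto intro!: nn_integral_cong simp: less_powr_iff indicator_def)
  have cake_W: "(\<integral>\<^sup>+\<omega>. ennreal (\<bar>W \<omega>\<bar> powr p) \<partial>N) = (\<integral>\<^sup>+t. indicator {0..} t * ennreal (r t) \<partial>lborel)"
    unfolding r_def using p
    by (subst N.nn_integral_layer_cake) (auto intro!: nn_integral_cong simp: less_powr_iff indicator_def)
  have q_le_w: "indicator {0..} t * ennreal (q n t) \<le> w t" if n: "n \<ge> n0" for n t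
  proof -
    consider "t < 0" | "0 \<le> t" "t < 1" | "t \<ge> 1" by linarith
    thus ?thesis
    proof cases
      case 1
      thus ?thesis by simp
    next
      case 2
      have "ennreal (q n t) \<le> 1" by (simp add: q_def ennreal_le_1)
      thus ?thesis using 2 by (simp add: w_def)
    next
      case 3
      have "q n t \<le> A * (t powr (1/p)) powr - m"
        unfolding q_def using 3 p by (intro n0 n ge_one_powr_ge_zero) auto
      also have "(t powr (1/p)) powr - m = t powr (- m / p)" by (simp add: powr_powr)
      finally have "ennreal (q n t) \<le> ennreal (A * t powr (- m / p))" by (rule ennreal_leI)
      also have "\<dots> = ennreal A * ennreal (t powr (- m / p))" by (rule ennreal_mult'') simp
      also have "\<dots> \<le> w t" using 3 by (simp add: w_def)
      finally show ?thesis using 3 by simp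
    qed
  qed
  have [measurable]: "q n \<in> borel_measurable borel" "r \<in> borel_measurable borel" for n
    unfolding q_def r_def by measurable
  have [measurable]: "w \<in> borel_measurable borel" unfolding w_def by measurable
  have w_fin: "(\<integral>\<^sup>+t. w t \<partial>lborel) < \<infinity>"
  proof -
    have "- m / p < -1" using p by (simp add: field_simps)
    hence "(\<integral>\<^sup>+t. ennreal (indicator {1..} t * t powr (- m / p)) \<partial>lborel) = ennreal (- (1 powr (- m / p + 1)) / (- m / p + 1))"
      by (intro nn_integral_has_integral_lebesgue has_integral_powr_to_inf) auto
    also have "(\<lambda>t. ennreal (indicator {1..} t * t powr (- m / p))) = (\<lambda>t. indicator {1..} t * ennreal (t powr (- m / p)))"
      by (auto simp: indicator_def fun_eq_iff)
    finally show ?thesis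
      unfolding w_def by (subst nn_integral_add) (auto simp: nn_integral_cmult ennreal_mult_less_top)
  qed
  have qr: "(\<lambda>n. q n t) \<longlonglongrightarrow> r t" for t
    unfolding q_def r_def by (rule tail_prob_abs_converges[OF M N Z W cdf atomless])
  have ind_lim: "(\<lambda>n. indicator {0..} t * ennreal (q (n + n0) t)) \<longlonglongrightarrow> indicator {0..} t * ennreal (r t)" for t
    using LIMSEQ_ignore_initial_segment[OF qr, of n0 t] by (auto simp: indicator_def)
  have "(\<lambda>n. \<integral>\<^sup>+t. indicator {0..} t * ennreal (q (n + n0) t) \<partial>lborel)
      \<longlonglongrightarrow> (\<integral>\<^sup>+t. indicator {0..} t * ennreal (r t) \<partial>lborel)"
    by (rule nn_integral_dominated_convergence[where w=w]) (use q_le_w w_fin ind_lim in auto)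
  hence lim: "(\<lambda>n. \<integral>\<^sup>+\<omega>. ennreal (\<bar>Z (n + n0) \<omega>\<bar> powr p) \<partial>M) \<longlonglongrightarrow> (\<integral>\<^sup>+\<omega>. ennreal (\<bar>W \<omega>\<bar> powr p) \<partial>N)"
    by (simp only: cake_Z cake_W)
  have fin_Z: "(\<integral>\<^sup>+\<omega>. ennreal (\<bar>Z n \<omega>\<bar> powr p) \<partial>M) < \<infinity>" if "n \<ge> n0" for n
    unfolding cake_Z by (rule le_less_trans[OF nn_integral_mono w_fin]) (rule q_le_w[OF that])
  have "indicator {0..} t * ennreal (r t) \<le> w t" for t
    by (rule LIMSEQ_le_const2[OF ind_lim]) (auto intro!: exI[of _ 0] q_le_w)
  hence fin_W: "(\<integral>\<^sup>+\<omega>. ennreal (\<bar>W \<omega>\<bar> powr p) \<partial>N) < \<infinity>"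
    unfolding cake_W by (intro le_less_trans[OF nn_integral_mono w_fin])
  have int_Z: "integrable M (\<lambda>\<omega>. \<bar>Z n \<omega>\<bar> powr p)" if "n \<ge> n0" for n
    by (rule integrableI_nonneg) (use fin_Z[OF that] in auto)
  have int_W: "integrable N (\<lambda>\<omega>. \<bar>W \<omega>\<bar> powr p)"
    by (rule integrableI_nonneg) (use fin_W in auto)
  have "(\<lambda>n. ennreal (M.expectation (\<lambda>\<omega>. \<bar>Z (n + n0) \<omega>\<bar> powr p))) \<longlonglongrightarrow> ennreal (N.expectation (\<lambda>\<omega>. \<bar>W \<omega>\<bar> powr p))"
    using lim int_Z int_W by (simp add: nn_integral_eq_integral)
  hence "(\<lambda>n. M.expectation (\<lambda>\<omega>. \<bar>Z (n + n0) \<omega>\<bar> powr p)) \<longlonglongrightarrow> N.expectation (\<lambda>\<omega>. \<bar>W \<omega>\<bar> powr p)"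
    by (subst (asm) tendsto_ennreal_iff) auto
  hence "(\<lambda>n. M.expectation (\<lambda>\<omega>. \<bar>Z n \<omega>\<bar> powr p)) \<longlonglongrightarrow> N.expectation (\<lambda>\<omega>. \<bar>W \<omega>\<bar> powr p)"
    by (rule LIMSEQ_offset)
  thus ?thesis using int_Z int_W by (auto simp: eventually_sequentially)
qed

section \<open>Uniform tail bounds for the order statistic\<close>

lemma exp_minus_le_powr:
  fixes s d m :: real
  assumes "s > 0" "d > 0" "m > 0"
  shows "exp (- (d * s)) \<le> (m / d) powr m * s powr - m"
proof -
  have "d * s / m \<le> exp (d * s / m)" using exp_ge_add_one_self[of "d * s / m"] by linarith
  hence "(d * s / m) powr m \<le> exp (d * s / m) powr m" using assms by (intro powr_mono2) auto
  also have "\<dots> = exp (d * s)" using assms by (simp add: powr_def)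
  finally have "exp (- (d * s)) \<le> 1 / (d * s / m) powr m"
    using assms by (simp add: exp_minus inverse_eq_divide le_divide_eq divide_le_eq)
  also have "\<dots> = (m / d) powr m * s powr - m"
    using assms by (simp add: powr_divide powr_mult powr_minus field_simps)
  finally show ?thesis .
qed

lemma one_minus_binomial_lt_le:
  assumes "0 \<le> p" "p \<le> 1" "k \<ge> 1"
  shows "1 - binomial_lt k n p \<le> real n * p"
proof -
  have "1 + real n * (- p) \<le> (1 + - p) ^ n" using assms by (intro Bernoulli_inequality) auto
  also have "\<dots> = real (n choose 0) * p ^ 0 * (1 - p) ^ (n - 0)" by simp
  also have "\<dots> \<le> binomial_lt k n p"
    unfolding binomial_lt_def using assms by (intro member_le_sum) auto
  finally show ?thesis by simp
qed

context weibull_type_tail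
begin

text \<open>The level exceeded with probability \<open>1 / n\<close> under the pure Weibull tail \<open>exp (- C * x powr \<tau>)\<close>.\<close>

definition weibull_quantile :: "nat \<Rightarrow> real" where "weibull_quantile n = (inverse C * ln (real n)) powr (1 / \<tau>)"

lemma weibull_quantile_pos: "n \<ge> 2 \<Longrightarrow> weibull_quantile n > 0"
  using C_pos by (simp add: weibull_quantile_def)

lemma exp_weibull_quantile:
  assumes "n \<ge> 2"
  shows "exp (C * weibull_quantile n powr \<tau>) = real n"
proof -
  have "weibull_quantile n powr \<tau> = inverse C * ln (real n)"
    using assms C_pos \<tau>_pos by (simp add: weibull_quantile_def powr_powr)
  hence "C * weibull_quantile n powr \<tau> = ln (real n)" using C_pos by simp
  thus ?thesis using assms by simp
qed

lemma weibull_quantile_at_top: "filterlim weibull_quantile at_top sequentially"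
  unfolding weibull_quantile_def[abs_def] using C_pos \<tau>_pos by real_asymp

lemma weibull_nu_eq: "weibull_nu C \<tau> n = nu_at (weibull_quantile n)"
proof -
  have "weibull_quantile n powr (1 - \<tau>) = (inverse C * ln (real n)) powr (1 / \<tau> - 1)"
    using \<tau>_pos by (simp add: weibull_quantile_def powr_powr diff_divide_distrib right_diff_distrib)
  thus ?thesis by (simp add: weibull_nu_def nu_at_def divide_inverse)
qed

lemma weibull_mu_eq: "weibull_mu C \<tau> \<rho> n = mu_at (weibull_quantile n)"
proof -
  have "weibull_quantile n powr (1 - \<tau>) = (inverse C * ln (real n)) powr (1 / \<tau> - 1)"
    using \<tau>_pos by (simp add: weibull_quantile_def powr_powr diff_divide_distrib right_diff_distrib)
  thus ?thesis by (simp add: weibull_mu_def mu_at_def flip: weibull_quantile_def) (simp add: divide_inverse)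
qed

lemma exceedance_rate_limit:
  "(\<lambda>n. real n * G (mu_at (weibull_quantile n) + nu_at (weibull_quantile n) * x)) \<longlonglongrightarrow> exp (- x)"
proof -
  have "(\<lambda>n. exp (C * weibull_quantile n powr \<tau>) * G (mu_at (weibull_quantile n) + nu_at (weibull_quantile n) * x)) \<longlonglongrightarrow> exp (- x)"
    by (rule filterlim_compose[OF tail_at_normalised_point weibull_quantile_at_top])
  moreover have "\<forall>\<^sub>F n in sequentially. exp (C * weibull_quantile n powr \<tau>) * G (mu_at (weibull_quantile n) + nu_at (weibull_quantile n) * x)
      = real n * G (mu_at (weibull_quantile n) + nu_at (weibull_quantile n) * x)"
    using eventually_ge_at_top[of 2] by eventually_elim (simp add: exp_weibull_quantile)
  ultimately show ?thesis by (rule Lim_transform_eventually)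
qed

text \<open>The power \<open>2 powr (- \<delta> * n)\<close> beats the powers of \<open>n\<close> and \<open>ln n\<close>, whatever the sign of the exponent
  \<open>1 / \<tau> - 1\<close> in \<open>nu_at\<close>.\<close>

lemma far_left_constant:
  assumes "\<delta> > 0"
  shows "\<forall>\<^sub>F n in sequentially. real k * real n ^ k * (nu_at (weibull_quantile n) / 2) powr - m
           * 2 powr (m - \<delta> * (real n - real k)) \<le> 1"
proof -
  define e where "e = 1 / \<tau> - 1"
  have "(\<lambda>n. real k * real n ^ k * (inverse (C * \<tau>) * (inverse C * ln (real n)) powr e / 2) powr - m
           * 2 powr (m - \<delta> * (real n - real k))) \<longlonglongrightarrow> 0"
    using C_pos \<tau>_pos assms by real_asymp
  hence "\<forall>\<^sub>F n in sequentially. real k * real n ^ k * (weibull_nu C \<tau> n / 2) powr - m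
           * 2 powr (m - \<delta> * (real n - real k)) < 1"
    unfolding weibull_nu_def e_def by (rule order_tendstoD) simp
  thus ?thesis unfolding weibull_nu_eq by eventually_elim simp
qed

text \<open>For the \<open>k\<close>th largest of \<open>n\<close> to lie below \<open>- w\<close>, at least \<open>n - k\<close> of the variables must lie there, so
  the polynomial decay of a single left tail is raised to the power \<open>n - k\<close>. A fixed part of that
  power supplies \<open>s powr - m\<close>; the rest, with \<open>w \<ge> 2\<close>, absorbs all factors depending on \<open>n\<close>.\<close>

lemma far_left_bound:
  assumes G1: "\<And>x. G x \<le> 1" and "\<delta> > 0" "m > 0"
    and left: "\<forall>\<^sub>F w in at_top. 1 - G (- w) \<le> w powr - \<delta>"
  shows "\<forall>\<^sub>F n in sequentially. \<forall>s>0. nu_at (weibull_quantile n) * s > 3 * mu_at (weibull_quantile n) \<longrightarrow>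
    binomial_lt k n (G (mu_at (weibull_quantile n) - nu_at (weibull_quantile n) * s)) \<le> s powr - m"
proof -
  obtain w0 where w0: "\<And>w. w \<ge> w0 \<Longrightarrow> 1 - G (- w) \<le> w powr - \<delta>"
    using left by (auto simp: eventually_at_top_linorder)
  have "\<forall>\<^sub>F n in sequentially. mu_at (weibull_quantile n) \<ge> max 1 w0"
    using filterlim_compose[OF mu_at_at_top weibull_quantile_at_top] unfolding filterlim_at_top by blast
  moreover have "\<forall>\<^sub>F n in sequentially. \<delta> * (real n - real k) \<ge> m"
    using assms by real_asymp
  ultimately show ?thesis
    using far_left_constant[OF \<open>\<delta> > 0\<close>, of k m] eventually_ge_at_top[of "k + 2"]
  proof (eventually_elim, intro allI impI)
    fix n :: nat and s :: real
    assume mu_large: "mu_at (weibull_quantile n) \<ge> max 1 w0" and e: "\<delta> * (real n - real k) \<ge> m" and n: "n \<ge> k + 2"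
      and const: "real k * real n ^ k * (nu_at (weibull_quantile n) / 2) powr - m * 2 powr (m - \<delta> * (real n - real k)) \<le> 1"
      and s: "s > 0" "nu_at (weibull_quantile n) * s > 3 * mu_at (weibull_quantile n)"
    define w where "w = nu_at (weibull_quantile n) * s - mu_at (weibull_quantile n)"
    have w: "w \<ge> 2" "w \<ge> w0" "w \<ge> nu_at (weibull_quantile n) * s / 2" using mu_large s unfolding w_def by linarith+
    have nu_pos: "nu_at (weibull_quantile n) > 0" using n weibull_quantile_pos nu_at_pos by auto
    have q: "0 \<le> 1 - G (- w)" "1 - G (- w) \<le> w powr - \<delta>" using w0 w G1 by auto
    have "(1 - G (- w)) ^ (n - k) \<le> (w powr - \<delta>) ^ (n - k)" using q by (intro power_mono) auto
    also have "\<dots> = w powr (- (\<delta> * (real n - real k)))"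
      using w n by (simp add: powr_powr flip: powr_realpow)
    also have "\<dots> = w powr - m * w powr (m - \<delta> * (real n - real k))" by (simp flip: powr_add)
    also have "\<dots> \<le> (nu_at (weibull_quantile n) * s / 2) powr - m * 2 powr (m - \<delta> * (real n - real k))"
      using w e nu_pos s \<open>m > 0\<close> by (intro mult_mono powr_mono2') auto
    also have "(nu_at (weibull_quantile n) * s / 2) powr - m = (nu_at (weibull_quantile n) / 2) powr - m * s powr - m"
      using nu_pos s powr_mult[of "nu_at (weibull_quantile n) / 2" s "- m"] by simp
    finally have pow: "(1 - G (- w)) ^ (n - k)
        \<le> (nu_at (weibull_quantile n) / 2) powr - m * 2 powr (m - \<delta> * (real n - real k)) * s powr - m"
      by (simp add: mult_ac)
    have "binomial_lt k n (G (- w)) \<le> real k * real n ^ k * (1 - G (- w)) ^ (n - k)"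
      using n G1 G_pos_all by (intro binomial_lt_bound_small_complement) (auto intro: less_imp_le)
    also have "\<dots> \<le> real k * real n ^ k *
        ((nu_at (weibull_quantile n) / 2) powr - m * 2 powr (m - \<delta> * (real n - real k)) * s powr - m)"
      by (intro mult_left_mono pow) auto
    also have "\<dots> = (real k * real n ^ k * (nu_at (weibull_quantile n) / 2) powr - m
        * 2 powr (m - \<delta> * (real n - real k))) * s powr - m"
      by (simp only: mult_ac)
    also have "\<dots> \<le> 1 * s powr - m" by (intro mult_right_mono const) auto
    finally show "binomial_lt k n (G (mu_at (weibull_quantile n) - nu_at (weibull_quantile n) * s)) \<le> s powr - m"
      by (simp add: w_def)
  qed
qed

text \<open>The two summands are the probabilities that the normalised order statistic exceeds \<open>s\<close> and that it
  is at most \<open>- s\<close>.\<close>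

lemma uniform_polynomial_tail:
  assumes G1: "\<And>x. G x \<le> 1" and "\<delta> > 0" "m > 0" "k \<ge> 1"
    and left: "\<forall>\<^sub>F w in at_top. 1 - G (- w) \<le> w powr - \<delta>"
  shows "\<exists>A. \<forall>\<^sub>F n in sequentially. \<forall>s\<ge>1.
    (1 - binomial_lt k n (G (mu_at (weibull_quantile n) + nu_at (weibull_quantile n) * s)))
      + binomial_lt k n (G (mu_at (weibull_quantile n) - nu_at (weibull_quantile n) * s)) \<le> A * s powr - m"
proof -
  obtain A where A: "\<forall>\<^sub>F b in at_top. \<forall>t>0. exp (C * b powr \<tau>) * G (mu_at b + nu_at b * t) \<le> A * t powr - m"
    using right_tail_bound[OF \<open>m > 0\<close>] by blast
  obtain c d where cd: "c > 0" "d > 0"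
    and growth: "\<forall>\<^sub>F b in at_top. \<forall>t\<ge>0. nu_at b * t \<le> 3 * mu_at b \<longrightarrow>
     c * exp (d * t) \<le> exp (C * b powr \<tau>) * G (mu_at b - nu_at b * t)"
    using left_tail_growth by blast
  define B where "B = real k ^ 2 / c * (m / d) powr m"
  have B: "B \<ge> 0" using cd by (simp add: B_def)
  have "\<forall>\<^sub>F n in sequentially. \<forall>s\<ge>1.
    (1 - binomial_lt k n (G (mu_at (weibull_quantile n) + nu_at (weibull_quantile n) * s)))
      + binomial_lt k n (G (mu_at (weibull_quantile n) - nu_at (weibull_quantile n) * s)) \<le> (A + B + 1) * s powr - m"
    using eventually_compose_filterlim[OF A weibull_quantile_at_top] eventually_compose_filterlim[OF growth weibull_quantile_at_top]
      far_left_bound[OF G1 \<open>\<delta> > 0\<close> \<open>m > 0\<close> left, of k] eventually_ge_at_top[of 2]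
  proof (eventually_elim, intro allI impI)
    fix n :: nat and s :: real
    assume n: "2 \<le> n" and s: "s \<ge> 1"
      and right: "\<forall>t>0. exp (C * weibull_quantile n powr \<tau>) * G (mu_at (weibull_quantile n) + nu_at (weibull_quantile n) * t) \<le> A * t powr - m"
      and near: "\<forall>t\<ge>0. nu_at (weibull_quantile n) * t \<le> 3 * mu_at (weibull_quantile n) \<longrightarrow>
        c * exp (d * t) \<le> exp (C * weibull_quantile n powr \<tau>) * G (mu_at (weibull_quantile n) - nu_at (weibull_quantile n) * t)"
      and far: "\<forall>s>0. nu_at (weibull_quantile n) * s > 3 * mu_at (weibull_quantile n) \<longrightarrow>
        binomial_lt k n (G (mu_at (weibull_quantile n) - nu_at (weibull_quantile n) * s)) \<le> s powr - m"
    have "1 - binomial_lt k n (G (mu_at (weibull_quantile n) + nu_at (weibull_quantile n) * s)) \<le> real n * G (mu_at (weibull_quantile n) + nu_at (weibull_quantile n) * s)"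
      using G1 G_pos_all \<open>k \<ge> 1\<close> by (intro one_minus_binomial_lt_le) (auto intro: less_imp_le)
    also have "\<dots> \<le> A * s powr - m" using right s n by (auto simp: exp_weibull_quantile)
    finally have R: "1 - binomial_lt k n (G (mu_at (weibull_quantile n) + nu_at (weibull_quantile n) * s)) \<le> A * s powr - m" .
    have "binomial_lt k n (G (mu_at (weibull_quantile n) - nu_at (weibull_quantile n) * s)) \<le> (B + 1) * s powr - m"
    proof (cases "nu_at (weibull_quantile n) * s \<le> 3 * mu_at (weibull_quantile n)")
      case True
      let ?p = "G (mu_at (weibull_quantile n) - nu_at (weibull_quantile n) * s)"
      have np: "c * exp (d * s) \<le> real n * ?p" using near True s n by (auto simp: exp_weibull_quantile)
      have "binomial_lt k n ?p \<le> real k ^ 2 / (real n * ?p)"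
        using n G1 G_pos_all by (intro binomial_lt_bound) auto
      also have "\<dots> \<le> real k ^ 2 / (c * exp (d * s))"
        using np cd n G_pos_all by (intro divide_left_mono) auto
      also have "\<dots> = real k ^ 2 / c * exp (- (d * s))" by (simp add: exp_minus field_simps)
      also have "\<dots> \<le> real k ^ 2 / c * ((m / d) powr m * s powr - m)"
        using cd s \<open>m > 0\<close> by (intro mult_left_mono exp_minus_le_powr) auto
      also have "\<dots> = B * s powr - m" by (simp add: B_def)
      also have "\<dots> \<le> (B + 1) * s powr - m" by (intro mult_right_mono) auto
      finally show ?thesis .
    next
      case False
      hence "binomial_lt k n (G (mu_at (weibull_quantile n) - nu_at (weibull_quantile n) * s)) \<le> 1 * s powr - m" using far s by auto
      also have "\<dots> \<le> (B + 1) * s powr - m" using B by (intro mult_right_mono) auto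
      finally show ?thesis .
    qed
    with R show "(1 - binomial_lt k n (G (mu_at (weibull_quantile n) + nu_at (weibull_quantile n) * s)))
      + binomial_lt k n (G (mu_at (weibull_quantile n) - nu_at (weibull_quantile n) * s)) \<le> (A + B + 1) * s powr - m"
      by (simp add: algebra_simps)
  qed
  thus ?thesis by blast
qed

end

section \<open>Convergence of the moments of the order statistic\<close>

text \<open>The limit law \<open>- ln E\<close> has the Poisson probabilities with mean \<open>exp (- x)\<close> as distribution
  function, through the formula for the Erlang distribution function.\<close>

lemma (in prob_space) prob_neg_ln_erlang:
  assumes E: "erlang_distributed M E k" and k: "k \<ge> 1"
  shows "E \<in> borel_measurable M"
    and "\<P>(\<omega> in M. - ln (E \<omega>) = x) = 0"
    and "\<P>(\<omega> in M. - ln (E \<omega>) \<le> x) = (\<Sum>j<k. exp (- x) ^ j / fact j * exp (- exp (- x)))"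
proof -
  have D: "distributed M lborel E (erlang_density (k - 1) 1)"
    using E by (simp add: erlang_distributed_def)
  show [measurable]: "E \<in> borel_measurable M" using distributed_measurable[OF D] by simp
  have pos: "AE \<omega> in M. E \<omega> > 0"
  proof -
    have "\<P>(\<omega> in M. E \<omega> \<le> 0) = 0"
      using erlang_distributed_le[OF D, of 0] by (simp add: erlang_CDF_at0)
    hence "AE \<omega> in M. \<not> E \<omega> \<le> 0" by (subst (asm) prob_eq_0) auto
    thus ?thesis by (simp add: not_le)
  qed
  have ne: "AE \<omega> in M. E \<omega> \<noteq> a" for a
  proof -
    have "emeasure M (E -` {a} \<inter> space M) = (\<integral>\<^sup>+x. ennreal (erlang_density (k - 1) 1 x) * indicator {a} x \<partial>lborel)"
      by (rule distributed_emeasure[OF D]) simp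
    also have "\<dots> = 0" by (simp add: nn_integral_null_set)
    finally have "E -` {a} \<inter> space M \<in> null_sets M" by auto
    thus ?thesis by (rule AE_I') auto
  qed
  have "AE \<omega> in M. - ln (E \<omega>) \<noteq> x"
    using pos ne[of "exp (- x)"]
  proof eventually_elim
    case (elim \<omega>)
    show ?case
    proof
      assume "- ln (E \<omega>) = x"
      hence "exp (- x) = exp (ln (E \<omega>))" by simp
      thus False using elim by simp
    qed
  qed
  thus "\<P>(\<omega> in M. - ln (E \<omega>) = x) = 0" by (subst prob_eq_0) auto
  have "\<P>(\<omega> in M. - ln (E \<omega>) \<le> x) = \<P>(\<omega> in M. exp (- x) < E \<omega>)"
  proof (intro finite_measure_eq_AE)
    show "AE \<omega> in M. \<omega> \<in> {\<omega> \<in> space M. - ln (E \<omega>) \<le> x} \<longleftrightarrow> \<omega> \<in> {\<omega> \<in> space M. exp (- x) < E \<omega>}"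
      using pos ne[of "exp (- x)"]
    proof eventually_elim
      case (elim \<omega>)
      have "- ln (E \<omega>) \<le> x \<longleftrightarrow> exp (- x) \<le> E \<omega>" using elim(1) by (metis ln_ge_iff minus_le_iff)
      thus ?case using elim(2) by auto
    qed
  qed measurable
  also have "\<dots> = 1 - erlang_CDF (k - 1) 1 (exp (- x))" by (rule erlang_distributed_gt[OF D]) auto
  also have "\<dots> = (\<Sum>j\<le>k - 1. exp (- x) ^ j / fact j * exp (- exp (- x)))" by (simp add: erlang_CDF_def)
  also have "{..k - 1} = {..<k}" using k by auto
  finally show "\<P>(\<omega> in M. - ln (E \<omega>) \<le> x) = (\<Sum>j<k. exp (- x) ^ j / fact j * exp (- exp (- x)))" .
qed

lemma order_stat_measurable:
  fixes Y :: "nat \<Rightarrow> 'a \<Rightarrow> real"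
  assumes Y: "\<And>i. i \<ge> 1 \<Longrightarrow> Y i \<in> borel_measurable M" and "1 \<le> k" "k \<le> n"
  shows "order_stat Y k n \<in> borel_measurable M"
proof (rule borel_measurableI_le)
  fix y
  have [measurable]: "Y i \<in> borel_measurable M" if "i \<in> {1..n}" for i
    using Y that by simp
  have card_eq: "real (card {i\<in>{1..n}. y < Y i \<omega>}) = (\<Sum>i\<in>{1..n}. if y < Y i \<omega> then 1 else 0)" for \<omega>
    by (simp add: sum.If_cases Int_def)
  have "card {i\<in>{1..n}. y < Y i \<omega>} < k \<longleftrightarrow> (\<Sum>i\<in>{1..n}. if y < Y i \<omega> then 1 else 0) < real k" for \<omega>
    unfolding card_eq[symmetric] by (rule of_nat_less_iff[symmetric])
  hence "{\<omega>\<in>space M. order_stat Y k n \<omega> \<le> y} = {\<omega>\<in>space M. (\<Sum>i\<in>{1..n}. if y < Y i \<omega> then 1 else 0) < real k}"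
    unfolding order_stat_le_iff[OF assms(2,3)] by simp
  also have "\<dots> \<in> sets M" by measurable
  finally show "{\<omega>\<in>space M. order_stat Y k n \<omega> \<le> y} \<in> sets M" .
qed

lemma (in prob_space) weibull_type_tailI:
  fixes X :: "'a \<Rightarrow> real"
  assumes [measurable]: "X \<in> borel_measurable M"
    and W: "generalized_Weibull_like F C \<tau> \<rho>" and eq: "right_tail_equivalent M X F"
  obtains \<gamma> where "weibull_type_tail (\<lambda>x. \<P>(\<omega> in M. X \<omega> > x)) \<rho> C \<tau> \<gamma>"
proof -
  from W obtain \<gamma> x0 where pos: "C > 0" "\<tau> > 0" and rv: "regularly_varying \<rho> \<gamma>"
    and x0: "\<And>x. x \<ge> x0 \<Longrightarrow> \<rho> x > 0 \<and> F x = 1 - \<rho> x * exp (- C * x powr \<tau>)"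
    unfolding generalized_Weibull_like_def by blast
  have "weibull_type_tail (\<lambda>x. \<P>(\<omega> in M. X \<omega> > x)) \<rho> C \<tau> \<gamma>"
  proof
    show "antimono (\<lambda>x. \<P>(\<omega> in M. X \<omega> > x))"
      by (intro antimonoI finite_measure_mono) auto
    show "\<forall>\<^sub>F x in at_top. \<rho> x > 0"
      using eventually_ge_at_top[of x0] by eventually_elim (simp add: x0)
    show "((\<lambda>x. \<rho> (t * x) / \<rho> x) \<longlongrightarrow> t powr \<gamma>) at_top" if "t > 0" for t
      using rv that by (simp add: regularly_varying_def)
    have "((\<lambda>x. if \<P>(\<omega> in M. X \<omega> > x) = 0 \<and> 1 - F x = 0 then 1
        else \<P>(\<omega> in M. X \<omega> > x) / (1 - F x)) \<longlongrightarrow> 1) at_top"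
      using eq by (simp add: right_tail_equivalent_def asymp_equiv_def)
    moreover have "\<forall>\<^sub>F x in at_top. (if \<P>(\<omega> in M. X \<omega> > x) = 0 \<and> 1 - F x = 0 then 1
        else \<P>(\<omega> in M. X \<omega> > x) / (1 - F x)) = \<P>(\<omega> in M. X \<omega> > x) / (\<rho> x * exp (- C * x powr \<tau>))"
      using eventually_ge_at_top[of x0]
    proof eventually_elim
      case (elim x)
      show ?case using x0[OF elim] by simp
    qed
    ultimately show "((\<lambda>x. \<P>(\<omega> in M. X \<omega> > x) / (\<rho> x * exp (- C * x powr \<tau>))) \<longlongrightarrow> 1) at_top"
      by (rule Lim_transform_eventually)
  qed (use pos in auto)
  thus ?thesis by (rule that)
qed

text \<open>Halving the exponent absorbs the constant; halving the argument passes from \<open>X < - w\<close> to \<open>X \<le> - w\<close>.\<close>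

lemma (in prob_space) left_tail_power_bound:
  fixes X :: "'a \<Rightarrow> real"
  assumes [measurable]: "X \<in> borel_measurable M" and "\<eta> > 0"
    and L: "Limsup at_top (\<lambda>x::real. ereal (\<P>(\<omega> in M. X \<omega> < - x) * x powr \<eta>)) < \<infinity>"
  shows "\<forall>\<^sub>F w in at_top. 1 - \<P>(\<omega> in M. X \<omega> > - w) \<le> w powr - (\<eta> / 2)"
proof -
  obtain B where "Limsup at_top (\<lambda>x::real. ereal (\<P>(\<omega> in M. X \<omega> < - x) * x powr \<eta>)) < ereal B"
    using less_PInf_Ex_of_nat[THEN iffD1, OF less_imp_neq[OF L]] by blast
  hence lim: "\<forall>\<^sub>F x in at_top. ereal (\<P>(\<omega> in M. X \<omega> < - x) * x powr \<eta>) < ereal B"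
    by (rule Limsup_lessD)
  have "filterlim (\<lambda>w::real. w / 2) at_top at_top" by real_asymp
  from eventually_compose_filterlim[OF lim this]
  have "\<forall>\<^sub>F w in at_top. \<P>(\<omega> in M. X \<omega> < - (w / 2)) * (w / 2) powr \<eta> < B" by simp
  moreover have "\<forall>\<^sub>F w::real in at_top. B * (w / 2) powr - \<eta> \<le> w powr - (\<eta> / 2)"
    using \<open>\<eta> > 0\<close> by real_asymp
  ultimately show ?thesis using eventually_gt_at_top[of 0]
  proof eventually_elim
    case (elim w)
    have "1 - \<P>(\<omega> in M. X \<omega> > - w) = prob (space M - {\<omega>\<in>space M. X \<omega> > - w})"
      by (simp add: prob_compl)
    also have "\<dots> \<le> \<P>(\<omega> in M. X \<omega> < - (w / 2))"
      using elim by (intro finite_measure_mono) auto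
    also have "\<dots> \<le> B * (w / 2) powr - \<eta>"
      using elim by (simp add: powr_minus field_simps)
    finally show ?case using elim by linarith
  qed
qed

theorem proposition2p3:
  fixes M :: "'a measure" and Y :: "nat \<Rightarrow> 'a \<Rightarrow> real"
    and N :: "'b measure" and E :: "'b \<Rightarrow> real"
    and F \<rho> :: "real \<Rightarrow> real" and C \<tau> \<eta> lam :: real and k :: nat
  assumes "prob_space M"
    and "prob_space.indep_vars M (\<lambda>_. borel) Y {1..}"
    and "\<forall>i\<ge>1. distr M borel (Y i) = distr M borel (Y 1)"
    and "generalized_Weibull_like F C \<tau> \<rho>"
    and "right_tail_equivalent M (Y 1) F"
    and "\<eta> > 0"
    and "Limsup at_top (\<lambda>x::real. ereal (\<P>(\<omega> in M. Y 1 \<omega> < - x) * x powr \<eta>)) < \<infinity>"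
    and "k \<ge> 1"
    and "prob_space N"
    and "erlang_distributed N E k"
    and "lam > 0"
  shows "(\<forall>\<^sub>F n in sequentially. integrable M
           (\<lambda>\<omega>. \<bar>inverse (weibull_nu C \<tau> n) * (order_stat Y k n \<omega> - weibull_mu C \<tau> \<rho> n)\<bar> powr lam)) \<and>
         integrable N (\<lambda>\<omega>. \<bar>- ln (E \<omega>)\<bar> powr lam) \<and>
         (\<lambda>n. prob_space.expectation M
           (\<lambda>\<omega>. \<bar>inverse (weibull_nu C \<tau> n) * (order_stat Y k n \<omega> - weibull_mu C \<tau> \<rho> n)\<bar> powr lam))
         \<longlonglongrightarrow> prob_space.expectation N (\<lambda>\<omega>. \<bar>- ln (E \<omega>)\<bar> powr lam)"
proof -
  interpret M: prob_space M by fact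
  interpret N: prob_space N by fact
  note ind = assms(2) and ident = assms(3) and k = \<open>k \<ge> 1\<close>
  have Y [measurable]: "Y i \<in> borel_measurable M" if "i \<ge> 1" for i
    using ind that by (auto simp: M.indep_vars_def)
  define G where "G = (\<lambda>x. \<P>(\<omega> in M. Y 1 \<omega> > x))"
  have G1: "G x \<le> 1" for x by (simp add: G_def)
  obtain \<gamma> where "weibull_type_tail G \<rho> C \<tau> \<gamma>"
    unfolding G_def by (rule M.weibull_type_tailI[OF Y[of 1] assms(4,5)]) auto
  then interpret weibull_type_tail G \<rho> C \<tau> \<gamma> .
  define Z where "Z n \<omega> = inverse (weibull_nu C \<tau> n) * (order_stat Y k n \<omega> - weibull_mu C \<tau> \<rho> n)" for n \<omega>
  have Z_le_iff: "Z n \<omega> \<le> x \<longleftrightarrow> order_stat Y k n \<omega> \<le> mu_at (weibull_quantile n) + nu_at (weibull_quantile n) * x" if "n \<ge> 2" for n \<omega> x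
    using nu_at_pos[OF weibull_quantile_pos[OF that]]
    by (simp add: Z_def weibull_nu_eq weibull_mu_eq inverse_eq_divide divide_le_eq algebra_simps)
  have Z_meas: "Z n \<in> borel_measurable M" if "n \<ge> k" for n
  proof -
    have [measurable]: "order_stat Y k n \<in> borel_measurable M"
      using that k by (intro order_stat_measurable) auto
    show ?thesis unfolding Z_def by measurable
  qed
  have Z_cdf: "\<P>(\<omega> in M. Z n \<omega> \<le> x) = binomial_lt k n (G (mu_at (weibull_quantile n) + nu_at (weibull_quantile n) * x))"
    if "n \<ge> k + 1" for n x
  proof -
    have "\<P>(\<omega> in M. Z n \<omega> \<le> x)
        = \<P>(\<omega> in M. card {i\<in>{1..n}. mu_at (weibull_quantile n) + nu_at (weibull_quantile n) * x < Y i \<omega>} < k)"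
      using that k by (intro arg_cong[where f=M.prob]) (auto simp: Z_le_iff order_stat_le_iff)
    also have "\<dots> = binomial_lt k n (G (mu_at (weibull_quantile n) + nu_at (weibull_quantile n) * x))"
      using that k by (intro M.prob_card_exceedances[OF ind ident]) (auto simp: G_def)
    finally show ?thesis .
  qed
  define m where "m = lam + 1"
  obtain A where A: "\<forall>\<^sub>F n in sequentially. \<forall>s\<ge>1.
    (1 - binomial_lt k n (G (mu_at (weibull_quantile n) + nu_at (weibull_quantile n) * s)))
      + binomial_lt k n (G (mu_at (weibull_quantile n) - nu_at (weibull_quantile n) * s)) \<le> A * s powr - m"
    using uniform_polynomial_tail[of "\<eta> / 2" m k] G1 k assms(6,11)
      M.left_tail_power_bound[OF Y[of 1] assms(6,7)] by (auto simp: m_def G_def)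
  have bound: "\<forall>\<^sub>F n in sequentially. \<forall>s\<ge>1. \<P>(\<omega> in M. s < \<bar>Z n \<omega>\<bar>) \<le> A * s powr - m"
    using A eventually_ge_at_top[of "k + 1"]
  proof (eventually_elim, intro allI impI)
    fix n :: nat and s :: real
    assume n: "n \<ge> k + 1" and s: "s \<ge> 1" and A: "\<forall>s\<ge>1.
      (1 - binomial_lt k n (G (mu_at (weibull_quantile n) + nu_at (weibull_quantile n) * s)))
      + binomial_lt k n (G (mu_at (weibull_quantile n) - nu_at (weibull_quantile n) * s)) \<le> A * s powr - m"
    have [measurable]: "Z n \<in> borel_measurable M" using n by (intro Z_meas) simp
    have "\<P>(\<omega> in M. s < \<bar>Z n \<omega>\<bar>) \<le> M.prob ((space M - {\<omega>\<in>space M. Z n \<omega> \<le> s}) \<union> {\<omega>\<in>space M. Z n \<omega> \<le> - s})"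
      by (intro M.finite_measure_mono) auto
    also have "\<dots> \<le> M.prob (space M - {\<omega>\<in>space M. Z n \<omega> \<le> s}) + \<P>(\<omega> in M. Z n \<omega> \<le> - s)"
      by (intro measure_subadditive) (auto simp: M.emeasure_eq_measure)
    also have "\<dots> = (1 - \<P>(\<omega> in M. Z n \<omega> \<le> s)) + \<P>(\<omega> in M. Z n \<omega> \<le> - s)"
      by (simp add: M.prob_compl)
    also have "\<dots> \<le> A * s powr - m" using A s n by (simp add: Z_cdf)
    finally show "\<P>(\<omega> in M. s < \<bar>Z n \<omega>\<bar>) \<le> A * s powr - m" .
  qed
  have cdf: "(\<lambda>n. \<P>(\<omega> in M. Z n \<omega> \<le> x)) \<longlonglongrightarrow> \<P>(\<omega> in N. - ln (E \<omega>) \<le> x)" for x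
  proof -
    have "(\<lambda>n. binomial_lt k n (G (mu_at (weibull_quantile n) + nu_at (weibull_quantile n) * x)))
        \<longlonglongrightarrow> \<P>(\<omega> in N. - ln (E \<omega>) \<le> x)"
      unfolding N.prob_neg_ln_erlang(3)[OF assms(10) k]
      by (intro binomial_lt_poisson_limit exceedance_rate_limit)
    moreover have "\<forall>\<^sub>F n in sequentially.
        binomial_lt k n (G (mu_at (weibull_quantile n) + nu_at (weibull_quantile n) * x)) = \<P>(\<omega> in M. Z n \<omega> \<le> x)"
      using eventually_ge_at_top[of "k + 1"] by eventually_elim (simp add: Z_cdf)
    ultimately show ?thesis by (rule Lim_transform_eventually)
  qed
  have [measurable]: "E \<in> borel_measurable N" by (rule N.prob_neg_ln_erlang(1)[OF assms(10) k])
  \<comment> \<open>The order statistic is meaningful only for at least \<open>k\<close> variables, hence the shift.\<close>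
  have "(\<forall>\<^sub>F n in sequentially. integrable M (\<lambda>\<omega>. \<bar>Z (n + k) \<omega>\<bar> powr lam)) \<and>
    integrable N (\<lambda>\<omega>. \<bar>- ln (E \<omega>)\<bar> powr lam) \<and>
    (\<lambda>n. M.expectation (\<lambda>\<omega>. \<bar>Z (n + k) \<omega>\<bar> powr lam)) \<longlonglongrightarrow> N.expectation (\<lambda>\<omega>. \<bar>- ln (E \<omega>)\<bar> powr lam)"
  proof (rule absolute_moments_converge[where m=m and A=A])
    show "(\<lambda>n. \<P>(\<omega> in M. Z (n + k) \<omega> \<le> x)) \<longlonglongrightarrow> \<P>(\<omega> in N. - ln (E \<omega>) \<le> x)" for x
      by (rule LIMSEQ_ignore_initial_segment[OF cdf])
    show "\<P>(\<omega> in N. - ln (E \<omega>) = x) = 0" for x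
      by (rule N.prob_neg_ln_erlang(2)[OF assms(10) k])
    show "\<forall>\<^sub>F n in sequentially. \<forall>s\<ge>1. \<P>(\<omega> in M. s < \<bar>Z (n + k) \<omega>\<bar>) \<le> A * s powr - m"
      using bound by (rule sequentially_offset)
  qed (use assms Z_meas in \<open>auto simp: m_def\<close>)
  hence "(\<forall>\<^sub>F n in sequentially. integrable M (\<lambda>\<omega>. \<bar>Z n \<omega>\<bar> powr lam)) \<and>
    integrable N (\<lambda>\<omega>. \<bar>- ln (E \<omega>)\<bar> powr lam) \<and>
    (\<lambda>n. M.expectation (\<lambda>\<omega>. \<bar>Z n \<omega>\<bar> powr lam)) \<longlonglongrightarrow> N.expectation (\<lambda>\<omega>. \<bar>- ln (E \<omega>)\<bar> powr lam)"
    by (auto intro: LIMSEQ_offset simp: eventually_sequentially_seg[of "\<lambda>n. integrable M (\<lambda>\<omega>. \<bar>Z n \<omega>\<bar> powr lam)"])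
  thus ?thesis unfolding Z_def .
qed

end
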